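(* Let $\Delta$ be a thick semi-regular right-angled building, let $A$ be an apartment of $\Delta$ and let $\alpha$ be a root of $A$. Then the root wing group $U_\alpha$ acts transitively on the set of apartments of $\Delta$ containing $\alpha$.
   Context: A Coxeter system $(W,S)$ ($S$ finite) is right-angled if all entries of its Coxeter matrix are $1,2$ or $\infty$; $l$ is the word length. A chamber system with index set $S$ is an edge-colored graph with color set $S$ such that for each $s\in S$ every $s$-panel (connected component of the graph formed by the edges of color $s$) is a complete graph with at least two vertices; vertices are called chambers. A right-angled building of type $(W,S)$ is a chamber system $\Delta$ with index set $S$ together with a Weyl distance $\delta\colon \mathrm{Ch}(\Delta)\times\mathrm{Ch}(\Delta)\to W$, where $(W,S)$ is right-angled, such that for every reduced word $w$ representing $\overline{w}\in W$: $\delta(c_1,c_2)=\overline{w}$ iff there is a gallery (path) of type $w$ (sequence of colors) from $c_1$ to $c_2$. It is thick if every panel has at least three chambers, and semi-regular if for each $s$ all $s$-panels have the same cardinality. $\mathrm{Aut}(\Delta)$ is the group of type-preserving automorphisms. The gallery distance is $\mathrm{dist}(c,d)=l(\delta(c,d))$. The standard thin building of type $(W,S)$ has chamber set $W$, $x\overset{s}{\sim}y$ iff $x^{-1}y=s$, and Weyl distance $\delta(x,y)=x^{-1}y$. An apartment of $\Delta$ is a subbuilding $\delta$-isometric to it. A root of an apartment $A$ is a set of the form $\{c\in A\mid \mathrm{dist}(c,x)<\mathrm{dist}(c,y)\}$ for two adjacent chambers $x,y$ of $A$; its complement in $A$ is the opposite root $-\alpha$. The wall $\partial\alpha$ of a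 root $\alpha$ of $A$ is the set of panels of $\Delta$ having chambers in both $\alpha$ and $-\alpha$; these panels all have the same type $s\in S$, called the type of $\alpha$. For a panel $\mathcal{P}$ and chamber $x$, $\mathrm{proj}_{\mathcal{P}}(x)$ is the unique chamber of $\mathcal{P}$ closest to $x$. For a chamber $c$ and $s\in S$, let $\mathcal{P}_{s,c}$ be the $s$-panel containing $c$; the $s$-wing of $c$ is $X_s(c)=\{x\in\mathrm{Ch}(\Delta)\mid \mathrm{proj}_{\mathcal{P}_{s,c}}(x)=c\}$. For a root $\alpha$ of $A$ of type $s$, choose $c\in\alpha$ with $\mathcal{P}_{s,c}\in\partial\alpha$; the root wing group is $U_\alpha:=\mathrm{Fix}_{\mathrm{Aut}(\Delta)}(X_s(c))$, the pointwise stabilizer of $X_s(c)$, which does not depend on the choice of $c$. *)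

theory Defs
  imports
    "HOL-Algebra.Multiplicative_Group"
    "HOL-Algebra.Group_Action"
    "HOL-Library.Extended_Nat"
    "HOL-Library.Equipollence"
begin

section \<open>Right-angled Coxeter systems\<close>

text \<open>
  The generating set \<open>S\<close> is a subset of the group \<open>W\<close>; words are lists over \<open>S\<close>.
\<close>

definition word_prod :: "'w monoid \<Rightarrow> 'w list \<Rightarrow> 'w" where
  "word_prod W ws = foldr (mult W) ws (one W)"

text \<open>\<^const>\<open>group.ord\<close> is 0 on elements of infinite order.\<close>

definition coxeter_matrix :: "'w monoid \<Rightarrow> 'w \<Rightarrow> 'w \<Rightarrow> enat" where
  "coxeter_matrix W s t =
     (let n = group.ord W (s \<otimes>\<^bsub>W\<^esub> t) in if n = 0 then \<infinity> else enat n)"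

text \<open>
  The congruence on words generated by the relations \<open>(st)\<^sup>m\<^sup>(\<^sup>s\<^sup>,\<^sup>t\<^sup>) = 1\<close> with \<open>m(s,t) < \<infinity>\<close>. Since
  \<open>m(s,s) = 1\<close> gives \<open>ss = 1\<close>, formal inverses of the letters are not needed, and the quotient is
  the group presented by these relations.
\<close>

inductive word_cong :: "'w monoid \<Rightarrow> 'w set \<Rightarrow> 'w list \<Rightarrow> 'w list \<Rightarrow> bool"
  for W S where
  rel: "\<lbrakk>s \<in> S; t \<in> S; coxeter_matrix W s t = enat n\<rbrakk>
        \<Longrightarrow> word_cong W S (concat (replicate n [s, t])) []"
| ctxt: "\<lbrakk>word_cong W S u v; a \<in> lists S; b \<in> lists S\<rbrakk>
        \<Longrightarrow> word_cong W S (a @ u @ b) (a @ v @ b)"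
| refl: "u \<in> lists S \<Longrightarrow> word_cong W S u u"
| sym: "word_cong W S u v \<Longrightarrow> word_cong W S v u"
| trans: "\<lbrakk>word_cong W S u v; word_cong W S v w\<rbrakk> \<Longrightarrow> word_cong W S u w"

definition coxeter_system :: "'w monoid \<Rightarrow> 'w set \<Rightarrow> bool" where
  "coxeter_system W S \<longleftrightarrow>
     group W \<and> finite S \<and> S \<subseteq> carrier W \<and>
     (\<forall>s\<in>S. group.ord W s = 2) \<and>
     generate W S = carrier W \<and>
     (\<forall>u\<in>lists S. \<forall>v\<in>lists S. word_prod W u = word_prod W v \<longleftrightarrow> word_cong W S u v)"

definition right_angled :: "'w monoid \<Rightarrow> 'w set \<Rightarrow> bool" where
  "right_angled W S \<longleftrightarrow> (\<forall>s\<in>S. \<forall>t\<in>S. coxeter_matrix W s t \<in> {1, 2, \<infinity>})"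

definition word_length :: "'w monoid \<Rightarrow> 'w set \<Rightarrow> 'w \<Rightarrow> nat" where
  "word_length W S w = (LEAST n. \<exists>ws\<in>lists S. length ws = n \<and> word_prod W ws = w)"

definition reduced_word :: "'w monoid \<Rightarrow> 'w set \<Rightarrow> 'w list \<Rightarrow> bool" where
  "reduced_word W S ws \<longleftrightarrow> ws \<in> lists S \<and> length ws = word_length W S (word_prod W ws)"

section \<open>Chamber systems and buildings\<close>

text \<open>\<open>adj \<Delta> s x y\<close>: there is an edge of colour \<open>s\<close> between the chambers \<open>x\<close> and \<open>y\<close>.\<close>

record ('c, 's) chamber_sys =
  chambers :: "'c set"
  adj :: "'s \<Rightarrow> 'c \<Rightarrow> 'c \<Rightarrow> bool"

definition panel :: "('c, 's, 'm) chamber_sys_scheme \<Rightarrow> 's \<Rightarrow> 'c \<Rightarrow> 'c set" where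
  "panel \<Delta> s c = {d \<in> chambers \<Delta>. (adj \<Delta> s)\<^sup>*\<^sup>* c d}"

definition panels_of_type :: "('c, 's, 'm) chamber_sys_scheme \<Rightarrow> 's \<Rightarrow> 'c set set" where
  "panels_of_type \<Delta> s = panel \<Delta> s ` chambers \<Delta>"

definition edge_colored_graph :: "'s set \<Rightarrow> ('c, 's, 'm) chamber_sys_scheme \<Rightarrow> bool" where
  "edge_colored_graph S \<Delta> \<longleftrightarrow>
     (\<forall>s x y. adj \<Delta> s x y \<longrightarrow>
        s \<in> S \<and> x \<in> chambers \<Delta> \<and> y \<in> chambers \<Delta> \<and> x \<noteq> y \<and> adj \<Delta> s y x) \<and>
     (\<forall>s t x y. adj \<Delta> s x y \<and> adj \<Delta> t x y \<longrightarrow> s = t)"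

definition chamber_system :: "'s set \<Rightarrow> ('c, 's, 'm) chamber_sys_scheme \<Rightarrow> bool" where
  "chamber_system S \<Delta> \<longleftrightarrow>
     edge_colored_graph S \<Delta> \<and>
     (\<forall>s\<in>S. \<forall>P\<in>panels_of_type \<Delta> s.
        (\<forall>x\<in>P. \<forall>y\<in>P. x \<noteq> y \<longrightarrow> adj \<Delta> s x y) \<and> (infinite P \<or> 2 \<le> card P))"

fun gallery :: "('c, 's, 'm) chamber_sys_scheme \<Rightarrow> 'c \<Rightarrow> 's list \<Rightarrow> 'c \<Rightarrow> bool" where
  "gallery \<Delta> c [] d \<longleftrightarrow> c \<in> chambers \<Delta> \<and> c = d"
| "gallery \<Delta> c (s # ws) d \<longleftrightarrow> (\<exists>e. adj \<Delta> s c e \<and> gallery \<Delta> e ws d)"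

record ('c, 'w) building = "('c, 'w) chamber_sys" +
  weyl_dist :: "'c \<Rightarrow> 'c \<Rightarrow> 'w"

definition right_angled_building :: "'w monoid \<Rightarrow> 'w set \<Rightarrow> ('c, 'w) building \<Rightarrow> bool" where
  "right_angled_building W S \<Delta> \<longleftrightarrow>
     coxeter_system W S \<and> right_angled W S \<and> chamber_system S \<Delta> \<and>
     (\<forall>c\<in>chambers \<Delta>. \<forall>d\<in>chambers \<Delta>. weyl_dist \<Delta> c d \<in> carrier W) \<and>
     (\<forall>ws. reduced_word W S ws \<longrightarrow>
        (\<forall>c\<in>chambers \<Delta>. \<forall>d\<in>chambers \<Delta>.
           weyl_dist \<Delta> c d = word_prod W ws \<longleftrightarrow> gallery \<Delta> c ws d))"

definition thick :: "'s set \<Rightarrow> ('c, 's, 'm) chamber_sys_scheme \<Rightarrow> bool" where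
  "thick S \<Delta> \<longleftrightarrow> (\<forall>s\<in>S. \<forall>P\<in>panels_of_type \<Delta> s. infinite P \<or> 3 \<le> card P)"

definition semi_regular :: "'s set \<Rightarrow> ('c, 's, 'm) chamber_sys_scheme \<Rightarrow> bool" where
  "semi_regular S \<Delta> \<longleftrightarrow>
     (\<forall>s\<in>S. \<forall>P\<in>panels_of_type \<Delta> s. \<forall>Q\<in>panels_of_type \<Delta> s. P \<approx> Q)"

definition gallery_dist :: "'w monoid \<Rightarrow> 'w set \<Rightarrow> ('c, 'w) building \<Rightarrow> 'c \<Rightarrow> 'c \<Rightarrow> nat" where
  "gallery_dist W S \<Delta> c d = word_length W S (weyl_dist \<Delta> c d)"

section \<open>Automorphisms\<close>

definition Aut :: "'s set \<Rightarrow> ('c, 's, 'm) chamber_sys_scheme \<Rightarrow> ('c \<Rightarrow> 'c) monoid" where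
  "Aut S \<Delta> = BijGroup (chambers \<Delta>)
     \<lparr>carrier := {g \<in> Bij (chambers \<Delta>).
        \<forall>s\<in>S. \<forall>x\<in>chambers \<Delta>. \<forall>y\<in>chambers \<Delta>. adj \<Delta> s (g x) (g y) \<longleftrightarrow> adj \<Delta> s x y}\<rparr>"

definition fixator :: "'s set \<Rightarrow> ('c, 's, 'm) chamber_sys_scheme \<Rightarrow> 'c set \<Rightarrow> ('c \<Rightarrow> 'c) set" where
  "fixator S \<Delta> X = {g \<in> carrier (Aut S \<Delta>). \<forall>x\<in>X. g x = x}"

section \<open>Apartments, roots and walls\<close>

definition standard_thin_building :: "'w monoid \<Rightarrow> 'w set \<Rightarrow> ('w, 'w) building" where
  "standard_thin_building W S =
     \<lparr>chambers = carrier W,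
      adj = (\<lambda>s x y. s \<in> S \<and> x \<in> carrier W \<and> y \<in> carrier W \<and> inv\<^bsub>W\<^esub> x \<otimes>\<^bsub>W\<^esub> y = s),
      weyl_dist = (\<lambda>x y. inv\<^bsub>W\<^esub> x \<otimes>\<^bsub>W\<^esub> y)\<rparr>"

definition induced :: "('c, 'w) building \<Rightarrow> 'c set \<Rightarrow> ('c, 'w) building" where
  "induced \<Delta> A =
     \<lparr>chambers = A, adj = (\<lambda>s x y. x \<in> A \<and> y \<in> A \<and> adj \<Delta> s x y), weyl_dist = weyl_dist \<Delta>\<rparr>"

definition subbuilding :: "'w monoid \<Rightarrow> 'w set \<Rightarrow> ('c, 'w) building \<Rightarrow> 'c set \<Rightarrow> bool" where
  "subbuilding W S \<Delta> A \<longleftrightarrow> A \<subseteq> chambers \<Delta> \<and> right_angled_building W S (induced \<Delta> A)"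

definition weyl_isometric :: "('b, 'w) building \<Rightarrow> ('c, 'w) building \<Rightarrow> bool" where
  "weyl_isometric \<Gamma> \<Delta> \<longleftrightarrow>
     (\<exists>f. bij_betw f (chambers \<Gamma>) (chambers \<Delta>) \<and>
        (\<forall>x\<in>chambers \<Gamma>. \<forall>y\<in>chambers \<Gamma>. weyl_dist \<Delta> (f x) (f y) = weyl_dist \<Gamma> x y))"

definition apartment :: "'w monoid \<Rightarrow> 'w set \<Rightarrow> ('c, 'w) building \<Rightarrow> 'c set \<Rightarrow> bool" where
  "apartment W S \<Delta> A \<longleftrightarrow>
     subbuilding W S \<Delta> A \<and> weyl_isometric (standard_thin_building W S) (induced \<Delta> A)"

definition is_root :: "'w monoid \<Rightarrow> 'w set \<Rightarrow> ('c, 'w) building \<Rightarrow> 'c set \<Rightarrow> 'c set \<Rightarrow> bool" where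
  "is_root W S \<Delta> A \<alpha> \<longleftrightarrow>
     (\<exists>s\<in>S. \<exists>x\<in>A. \<exists>y\<in>A. adj \<Delta> s x y \<and>
        \<alpha> = {c \<in> A. gallery_dist W S \<Delta> c x < gallery_dist W S \<Delta> c y})"

text \<open>The opposite root of \<open>\<alpha>\<close> is \<open>A - \<alpha>\<close>.\<close>

definition wall :: "'s set \<Rightarrow> ('c, 's, 'm) chamber_sys_scheme \<Rightarrow> 'c set \<Rightarrow> 'c set \<Rightarrow> 'c set set" where
  "wall S \<Delta> A \<alpha> =
     {P \<in> (\<Union>s\<in>S. panels_of_type \<Delta> s). P \<inter> \<alpha> \<noteq> {} \<and> P \<inter> (A - \<alpha>) \<noteq> {}}"

section \<open>Wings and root wing groups\<close>

definition proj_panel :: "'w monoid \<Rightarrow> 'w set \<Rightarrow> ('c, 'w) building \<Rightarrow> 'c set \<Rightarrow> 'c \<Rightarrow> 'c" where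
  "proj_panel W S \<Delta> P x = (THE c. is_arg_min (\<lambda>d. gallery_dist W S \<Delta> d x) (\<lambda>d. d \<in> P) c)"

definition wing :: "'w monoid \<Rightarrow> 'w set \<Rightarrow> ('c, 'w) building \<Rightarrow> 'w \<Rightarrow> 'c \<Rightarrow> 'c set" where
  "wing W S \<Delta> s c = {x \<in> chambers \<Delta>. proj_panel W S \<Delta> (panel \<Delta> s c) x = c}"

text \<open>
  \<open>root_wing_group W S \<Delta> A \<alpha> U\<close> says that \<open>U = U\<^sub>\<alpha>\<close>. It is a relation because \<open>U\<^sub>\<alpha>\<close> is defined through
  a choice of the chamber \<open>c\<close>, so a statement about every such \<open>U\<close> covers every choice. The type
  \<open>s\<close> of \<open>\<alpha>\<close> is determined by the requirement that the \<open>s\<close>-panel of \<open>c\<close> belongs to the wall.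
\<close>

definition root_wing_group ::
  "'w monoid \<Rightarrow> 'w set \<Rightarrow> ('c, 'w) building \<Rightarrow> 'c set \<Rightarrow> 'c set \<Rightarrow> ('c \<Rightarrow> 'c) set \<Rightarrow> bool" where
  "root_wing_group W S \<Delta> A \<alpha> U \<longleftrightarrow>
     (\<exists>s\<in>S. \<exists>c\<in>\<alpha>. panel \<Delta> s c \<in> wall S \<Delta> A \<alpha> \<and> U = fixator S \<Delta> (wing W S \<Delta> s c))"

lemma word_length_one: "word_length W S (one W) = 0"
  unfolding word_length_def by (rule Least_eq_0) (simp add: word_prod_def)

lemma word_length_generator:
  assumes "coxeter_system W S" "s \<in> S"
  shows "word_length W S s = 1"
proof -
  interpret group W using assms(1) by (simp add: coxeter_system_def)
  have s: "s \<in> carrier W" "ord s = 2" using assms by (auto simp: coxeter_system_def)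
  then have "s \<noteq> \<one>\<^bsub>W\<^esub>" using pow_eq_id[of s 1] by auto
  moreover have "word_prod W [s] = s" using s by (simp add: word_prod_def)
  ultimately show ?thesis
    unfolding word_length_def
  proof (intro Least_equality)
    show "\<exists>ws\<in>lists S. length ws = 1 \<and> word_prod W ws = s"
      by (rule bexI[of _ "[s]"]) (use \<open>word_prod W [s] = s\<close> assms(2) in simp_all)
  next
    fix n assume "\<exists>ws\<in>lists S. length ws = n \<and> word_prod W ws = s"
    with \<open>s \<noteq> \<one>\<^bsub>W\<^esub>\<close> have "n \<noteq> 0" by (auto simp: word_prod_def)
    then show "1 \<le> n" by simp
  qed
qed

lemma root_wing_group_exists:
  assumes B: "right_angled_building W S \<Delta>" and A: "apartment W S \<Delta> A" and R: "is_root W S \<Delta> A \<alpha>"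
  shows "\<exists>U. root_wing_group W S \<Delta> A \<alpha> U"
proof -
  interpret group W using B by (simp add: right_angled_building_def coxeter_system_def)
  have cox: "coxeter_system W S" and AC: "A \<subseteq> chambers \<Delta>"
    using A B by (auto simp: right_angled_building_def apartment_def subbuilding_def)
  from R obtain s x y where s: "s \<in> S" and xy: "x \<in> A" "y \<in> A" "adj \<Delta> s x y"
    and \<alpha>: "\<alpha> = {c \<in> A. gallery_dist W S \<Delta> c x < gallery_dist W S \<Delta> c y}"
    by (auto simp: is_root_def)
  have yx: "adj \<Delta> s y x"
    using xy(3) B
    unfolding right_angled_building_def chamber_system_def edge_colored_graph_def by blast
  have sW: "s \<in> carrier W" using s cox by (auto simp: coxeter_system_def)
  have red: "reduced_word W S []" "reduced_word W S [s]"
    using s sW word_length_one word_length_generator[OF cox s]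
    by (auto simp: reduced_word_def word_prod_def)
  have d: "weyl_dist \<Delta> c e = word_prod W ws"
    if "reduced_word W S ws" "gallery \<Delta> c ws e" "c \<in> chambers \<Delta>" "e \<in> chambers \<Delta>" for c e ws
    using B that unfolding right_angled_building_def by blast
  have d0: "gallery_dist W S \<Delta> c c = 0" if "c \<in> A" for c
  proof -
    have "c \<in> chambers \<Delta>" using that AC by blast
    then show ?thesis
      using d[OF red(1), of c c] by (simp add: gallery_dist_def word_prod_def word_length_one)
  qed
  have d1: "gallery_dist W S \<Delta> c e = 1" if "adj \<Delta> s c e" "c \<in> A" "e \<in> A" for c e
  proof -
    have "c \<in> chambers \<Delta>" "e \<in> chambers \<Delta>" using that AC by blast+
    then have "weyl_dist \<Delta> c e = word_prod W [s]"
      using d[OF red(2), of c e] that(1) by simp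
    then show ?thesis
      using sW word_length_generator[OF cox s] by (simp add: gallery_dist_def word_prod_def)
  qed
  have x: "x \<in> \<alpha>" and y: "y \<in> A - \<alpha>"
    using xy d0 d1[OF xy(3)] d1[OF yx] unfolding \<alpha> by auto
  have "x \<in> panel \<Delta> s x" "y \<in> panel \<Delta> s x"
    using xy AC by (auto simp: panel_def)
  then have "panel \<Delta> s x \<in> wall S \<Delta> A \<alpha>"
    using x y xy AC s unfolding wall_def panels_of_type_def by blast
  then show ?thesis using x s unfolding root_wing_group_def by blast
qed

end

theory Submission
  imports Defs "HOL-Combinatorics.Transposition"
begin

text \<open>
  Let \<open>c\<close> be the chamber of \<open>\<alpha>\<close> and \<open>s\<close> the type of \<open>\<alpha>\<close> in the definition of the root wing group. The
  fixator of the wing of \<open>c\<close> acts on the apartments that contain \<open>\<alpha>\<close> because \<open>\<alpha>\<close> lies in the wing. For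
  transitivity one needs, for two such apartments \<open>A\<close> and \<open>A'\<close>, an automorphism that fixes the wing
  and maps \<open>A\<close> to \<open>A'\<close>. It comes from a coordinate system on the building.

  Two \<open>t\<close>-panels are parallel when they lie in a common residue of type \<open>{t} \<union> t\<^sup>\<bottom>\<close>, where \<open>t\<^sup>\<bottom>\<close> is the
  set of generators that commute with \<open>t\<close> and differ from it. Such a residue is a product of a
  \<open>t\<close>-panel and a residue of type \<open>t\<^sup>\<bottom>\<close>. A colouring gives every chamber, for each \<open>t\<close>, a \<open>t\<close>-colour that
  is bijective on \<open>t\<close>-panels and constant on residues of type \<open>t\<^sup>\<bottom>\<close>, with a fixed colour for the
  chamber of a panel closest to \<open>c\<close>. Since different descents of an element of \<open>W\<close> commute, the types
  and colours along a reduced gallery from \<open>c\<close> form coordinates of its end chamber, unique up to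
  commutations, and two colourings \<open>h\<close>, \<open>h'\<close> give an automorphism that carries the coordinates for \<open>h\<close>
  to those for \<open>h'\<close> (\<open>coloring_automorphism\<close>).

  Colourings can be chosen independently in each residue of type \<open>{t} \<union> t\<^sup>\<bottom>\<close>, and semi-regularity
  provides the bijections. This leaves room to prescribe that in \<open>A\<close> all chambers not closest to \<open>c\<close>
  have one distinguished \<open>t\<close>-colour for \<open>h\<close>, and likewise in \<open>A'\<close> for \<open>h'\<close> (\<open>std_coloring\<close>); then \<open>A\<close> is
  mapped to \<open>A'\<close>. In residues where \<open>A\<close> and \<open>A'\<close> impose the same condition, \<open>h\<close> and \<open>h'\<close> are chosen
  equal. This covers all colours along reduced galleries from \<open>c\<close> inside the wing, because \<open>A\<close> and \<open>A'\<close>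
  meet the wing in the same set \<open>\<alpha>\<close>, so the wing is fixed pointwise (\<open>wing_fixing_automorphism\<close>).
\<close>

section \<open>Descents in right-angled Coxeter groups\<close>

(* Keeps facts "ws \<in> lists S" folded, so that they match the premises of the lemmas on words. *)
declare in_listsD [rule del] in_listsI [rule del]

locale ra_coxeter = group W for W :: "'w monoid" (structure) +
  fixes S :: "'w set"
  assumes cox: "coxeter_system W S" and ra: "right_angled W S"
begin

abbreviation "wp \<equiv> word_prod W"
abbreviation "len \<equiv> word_length W S"

lemma S_carrier [simp, intro]: "s \<in> S \<Longrightarrow> s \<in> carrier W"
  using cox unfolding coxeter_system_def by blast

lemma S_sq [simp]: "s \<in> S \<Longrightarrow> s \<otimes> s = \<one>"
proof -
  assume s: "s \<in> S"
  then have "ord s = 2" using cox unfolding coxeter_system_def by blast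
  then show ?thesis using pow_ord_eq_1[of s] s by (simp add: numeral_2_eq_2)
qed

lemma S_sq_cancel [simp]: "s \<in> S \<Longrightarrow> x \<in> carrier W \<Longrightarrow> s \<otimes> (s \<otimes> x) = x"
  by (metis S_carrier S_sq l_one m_assoc)

lemma S_sq_cancel_right [simp]: "s \<in> S \<Longrightarrow> x \<in> carrier W \<Longrightarrow> x \<otimes> s \<otimes> s = x"
  by (metis S_carrier S_sq r_one m_assoc)

lemma S_inv [simp]: "s \<in> S \<Longrightarrow> inv s = s"
  by (simp add: inv_equality)

lemma inv_cancel [simp]:
  "x \<in> carrier W \<Longrightarrow> y \<in> carrier W \<Longrightarrow> x \<otimes> (inv x \<otimes> y) = y"
  "x \<in> carrier W \<Longrightarrow> y \<in> carrier W \<Longrightarrow> inv x \<otimes> (x \<otimes> y) = y"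
  by (metis inv_closed l_inv l_one m_assoc r_inv)+

lemma wp_simps [simp]: "wp [] = \<one>" "wp (s # ws) = s \<otimes> wp ws"
  by (simp_all add: word_prod_def)

lemma wp_closed [simp]: "ws \<in> lists S \<Longrightarrow> wp ws \<in> carrier W"
  by (induction ws) auto

lemma wp_append [simp]: "u \<in> lists S \<Longrightarrow> v \<in> lists S \<Longrightarrow> wp (u @ v) = wp u \<otimes> wp v"
  by (induction u) (auto simp: m_assoc)

lemma wp_rev: "ws \<in> lists S \<Longrightarrow> wp (rev ws) = inv (wp ws)"
  by (induction ws) (auto simp: inv_mult_group in_lists_conv_set)

lemma wp_surj:
  assumes "w \<in> carrier W" obtains ws where "ws \<in> lists S" "wp ws = w"
proof -
  have "w \<in> generate W S" using assms cox unfolding coxeter_system_def by blast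
  then have "\<exists>ws\<in>lists S. wp ws = w"
  proof (induction rule: generate.induct)
    case one
    show ?case by (rule bexI[of _ "[]"]) auto
  next
    case (incl h)
    then show ?case by (intro bexI[of _ "[h]"]) auto
  next
    case (inv h)
    then show ?case by (intro bexI[of _ "[h]"]) auto
  next
    case (eng h1 h2)
    then obtain u v where "u \<in> lists S" "wp u = h1" "v \<in> lists S" "wp v = h2" by auto
    then show ?case by (intro bexI[of _ "u @ v"]) auto
  qed
  then show thesis using that by blast
qed

lemma len_le: "ws \<in> lists S \<Longrightarrow> len (wp ws) \<le> length ws"
  unfolding word_length_def by (rule Least_le) auto

lemma reduced_exists:
  assumes "w \<in> carrier W"
  obtains ws where "ws \<in> lists S" "wp ws = w" "length ws = len w" "reduced_word W S ws"
proof -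
  obtain us where "us \<in> lists S" "wp us = w" using wp_surj[OF assms] .
  then have "\<exists>n. \<exists>ws\<in>lists S. length ws = n \<and> wp ws = w" by blast
  from LeastI_ex[OF this] obtain ws where "ws \<in> lists S" "wp ws = w" "length ws = len w"
    unfolding word_length_def[symmetric] by blast
  then show thesis using that by (simp add: reduced_word_def)
qed

lemma len_mult_le:
  assumes "v \<in> carrier W" "w \<in> carrier W" shows "len (v \<otimes> w) \<le> len v + len w"
proof -
  obtain vs where vs: "vs \<in> lists S" "wp vs = v" "length vs = len v"
    using reduced_exists[OF assms(1)] by metis
  obtain ws where ws: "ws \<in> lists S" "wp ws = w" "length ws = len w"
    using reduced_exists[OF assms(2)] by metis
  show ?thesis using len_le[of "vs @ ws"] vs ws by simp
qed

lemma len_gen [simp]: "s \<in> S \<Longrightarrow> len s = 1"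
  using word_length_generator[OF cox] .

lemma len_one [simp]: "len \<one> = 0" by (rule word_length_one)

lemma len_0_iff: "w \<in> carrier W \<Longrightarrow> len w = 0 \<longleftrightarrow> w = \<one>"
  by (metis len_one length_0_conv reduced_exists wp_simps(1))

lemma len_inv [simp]: "w \<in> carrier W \<Longrightarrow> len (inv w) = len w"
proof -
  have le: "len (inv w) \<le> len w" if "w \<in> carrier W" for w
  proof -
    obtain ws where ws: "ws \<in> lists S" "wp ws = w" "length ws = len w"
      using reduced_exists[OF \<open>w \<in> carrier W\<close>] by metis
    then show ?thesis using len_le[of "rev ws"] wp_rev[OF ws(1)]
      by (simp add: in_lists_conv_set)
  qed
  assume "w \<in> carrier W"
  then show ?thesis using le[of w] le[of "inv w"] by simp
qed

lemma relator_cases: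
  assumes "s \<in> S" "t \<in> S" "coxeter_matrix W s t = enat n"
  shows "(n = 1 \<and> s = t) \<or> (n = 2 \<and> s \<otimes> t = t \<otimes> s)"
proof -
  have st: "s \<otimes> t \<in> carrier W" using assms by simp
  have o: "ord (s \<otimes> t) = n" and n: "n \<in> {1, 2}"
    using assms ra unfolding right_angled_def coxeter_matrix_def
    by (force simp: Let_def one_enat_def numeral_eq_enat split: if_splits)+
  show ?thesis
  proof (cases "n = 1")
    case True
    then have "s \<otimes> t = \<one>" using o pow_ord_eq_1[OF st] st by (metis nat_pow_eone)
    then have "s = t" using assms by (metis S_carrier S_inv inv_equality inv_inv)
    then show ?thesis using True by simp
  next
    case False
    then have n: "n = 2" using n by simp
    then have "(s \<otimes> t) \<otimes> (s \<otimes> t) = \<one>"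
      using o pow_ord_eq_1[OF st] st by (simp add: numeral_2_eq_2)
    then have "inv (s \<otimes> t) = s \<otimes> t" using st by (simp add: inv_equality)
    then have "s \<otimes> t = t \<otimes> s" using assms by (simp add: inv_mult_group)
    then show ?thesis using n by simp
  qed
qed

text \<open>
  The only use of the presentation of \<open>W\<close>: a function on words that does not change when \<open>ss\<close> or,
  for commuting letters, \<open>stst\<close> is deleted depends only on the element that the word represents.
\<close>

lemma word_invariant:
  assumes sq: "\<And>a b s. \<lbrakk>a \<in> lists S; b \<in> lists S; s \<in> S\<rbrakk> \<Longrightarrow> f (a @ [s, s] @ b) = f (a @ b)"
    and comm: "\<And>a b s t. \<lbrakk>a \<in> lists S; b \<in> lists S; s \<in> S; t \<in> S; s \<otimes> t = t \<otimes> s\<rbrakk>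
        \<Longrightarrow> f (a @ [s, t, s, t] @ b) = f (a @ b)"
    and "u \<in> lists S" "v \<in> lists S" "wp u = wp v"
  shows "f u = f v"
proof -
  have "word_cong W S u v" using assms(3-5) cox unfolding coxeter_system_def by blast
  then have "\<forall>a\<in>lists S. \<forall>b\<in>lists S. f (a @ u @ b) = f (a @ v @ b)"
  proof (induction rule: word_cong.induct)
    case (rel s t n)
    from relator_cases[OF rel] show ?case
      using sq comm rel by (auto simp: numeral_2_eq_2)
  next
    case (ctxt u v a b)
    show ?case
    proof (intro ballI)
      fix a' b' assume "a' \<in> lists S" "b' \<in> lists S"
      then show "f (a' @ (a @ u @ b) @ b') = f (a' @ (a @ v @ b) @ b')"
        using ctxt.IH[rule_format, of "a' @ a" "b @ b'"] ctxt.hyps by simp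
    qed
  qed auto
  from this[rule_format, of "[]" "[]"] show ?thesis by simp
qed

lemma parity_length:
  assumes "u \<in> lists S" "v \<in> lists S" "wp u = wp v" shows "even (length u) = even (length v)"
  by (rule word_invariant[of "\<lambda>u. even (length u)"]) (use assms in auto)

lemma parity_letter:
  assumes "u \<in> lists S" "v \<in> lists S" "wp u = wp v"
  shows "even (count_list u t) = even (count_list v t)"
  by (rule word_invariant[of "\<lambda>u. even (count_list u t)"]) (use assms in auto)

text \<open>
  The reflections crossed by a word, written so that multiplying the word on the right by the
  reflection of one of its letters deletes that letter (\<open>reflections_delete\<close>).
\<close>

fun reflections :: "'w list \<Rightarrow> 'w list" where
  "reflections [] = []"
| "reflections (s # ws) = (inv (wp ws) \<otimes> s \<otimes> wp ws) # reflections ws"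

lemma reflections_append:
  "u \<in> lists S \<Longrightarrow> v \<in> lists S \<Longrightarrow>
     reflections (u @ v) = map (\<lambda>r. inv (wp v) \<otimes> r \<otimes> wp v) (reflections u) @ reflections v"
  by (induction u) (auto simp: inv_mult_group m_assoc)

lemma reflections_closed: "ws \<in> lists S \<Longrightarrow> r \<in> set (reflections ws) \<Longrightarrow> r \<in> carrier W"
  by (induction ws) auto

text \<open>
  A relator contributes each of its reflections an even number of times, and it represents \<open>\<one>\<close>, so it
  does not conjugate the reflections contributed by the letters before it.
\<close>

lemma parity_reflections:
  assumes "u \<in> lists S" "v \<in> lists S" "wp u = wp v"
  shows "even (count_list (reflections u) r) = even (count_list (reflections v) r)"
proof (rule word_invariant[of "\<lambda>u. even (count_list (reflections u) r)"])
  fix a b s assume ab: "a \<in> lists S" "b \<in> lists S" and s: "s \<in> S"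
  have "wp ([s, s] @ b) = wp b" using ab s by simp
  moreover have "reflections ([s, s] @ b) = (inv (wp b) \<otimes> s \<otimes> wp b) # (inv (wp b) \<otimes> s \<otimes> wp b) # reflections b"
    using ab s by (simp add: inv_mult_group m_assoc)
  ultimately show "even (count_list (reflections (a @ [s, s] @ b)) r) = even (count_list (reflections (a @ b)) r)"
    using reflections_append[of a "[s,s] @ b"] reflections_append[of a b] ab s by simp
next
  fix a b s t
  assume ab: "a \<in> lists S" "b \<in> lists S" and s: "s \<in> S" and t: "t \<in> S" and c: "s \<otimes> t = t \<otimes> s"
  let ?P = "wp b" let ?x = "inv ?P \<otimes> s \<otimes> ?P" let ?y = "inv ?P \<otimes> t \<otimes> ?P"
  have P: "?P \<in> carrier W" using ab by simp
  have sts: "s \<otimes> (t \<otimes> (s \<otimes> p)) = t \<otimes> p" "t \<otimes> (s \<otimes> (t \<otimes> p)) = s \<otimes> p"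
    if p: "p \<in> carrier W" for p
  proof -
    have "t \<otimes> (s \<otimes> p) = s \<otimes> (t \<otimes> p)" using p s t c by (metis S_carrier m_assoc)
    then show "s \<otimes> (t \<otimes> (s \<otimes> p)) = t \<otimes> p" "t \<otimes> (s \<otimes> (t \<otimes> p)) = s \<otimes> p"
      using p s t by (metis S_carrier S_sq_cancel m_closed)+
  qed
  have 1: "wp ([s, t, s, t] @ b) = ?P"
    using ab s t P sts by simp
  have 2: "reflections ([s, t, s, t] @ b) = ?x # ?y # ?x # ?y # reflections b"
    using ab s t P sts by (simp add: inv_mult_group m_assoc)
  have 3: "[s, t, s, t] @ b \<in> lists S" using ab s t by simp
  show "even (count_list (reflections (a @ [s, t, s, t] @ b)) r) = even (count_list (reflections (a @ b)) r)"
    unfolding reflections_append[OF ab(1) 3] reflections_append[OF ab] 1 2 by simp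
qed (use assms in auto)

lemma reflections_delete:
  assumes "ws \<in> lists S" "r \<in> set (reflections ws)"
  obtains p x q where "ws = p @ x # q" "wp ws \<otimes> r = wp p \<otimes> wp q" "r = inv (wp q) \<otimes> x \<otimes> wp q"
    "p \<in> lists S" "x \<in> S" "q \<in> lists S"
proof -
  have "\<exists>p x q. ws = p @ x # q \<and> wp ws \<otimes> r = wp p \<otimes> wp q \<and> r = inv (wp q) \<otimes> x \<otimes> wp q"
    using assms
  proof (induction ws)
    case (Cons s ws)
    have ws: "ws \<in> lists S" "s \<in> S" using Cons by auto
    show ?case
    proof (cases "r \<in> set (reflections ws)")
      case True
      then obtain p x q where *: "ws = p @ x # q" "wp ws \<otimes> r = wp p \<otimes> wp q"
          "r = inv (wp q) \<otimes> x \<otimes> wp q" using Cons by auto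
      have "r \<in> carrier W" using reflections_closed[OF ws(1) True] .
      then have "wp (s # ws) \<otimes> r = wp (s # p) \<otimes> wp q"
        using ws * by (auto simp: m_assoc)
      then show ?thesis using * by (intro exI[of _ "s # p"] exI[of _ x] exI[of _ q]) auto
    next
      case False
      then have r: "r = inv (wp ws) \<otimes> s \<otimes> wp ws" using Cons by simp
      have "wp (s # ws) \<otimes> r = s \<otimes> (wp ws \<otimes> (inv (wp ws) \<otimes> (s \<otimes> wp ws)))"
        using r ws by (auto simp: m_assoc)
      also have "\<dots> = wp [] \<otimes> wp ws" using ws by auto
      finally show ?thesis using r by (intro exI[of _ "[]"] exI[of _ s] exI[of _ ws]) simp
    qed
  qed simp
  then obtain p x q where *: "ws = p @ x # q" "wp ws \<otimes> r = wp p \<otimes> wp q"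
    "r = inv (wp q) \<otimes> x \<otimes> wp q" by blast
  moreover have "p \<in> lists S" "x \<in> S" "q \<in> lists S" using assms(1) unfolding *(1) by auto
  ultimately show thesis using that by blast
qed

text \<open>
  The right descent set. For chambers, \<open>t \<in> desc (\<delta> x y)\<close> says that \<open>y\<close> is not the chamber closest to \<open>x\<close>
  in its \<open>t\<close>-panel.
\<close>

definition desc :: "'w \<Rightarrow> 'w set" where
  "desc w = {s \<in> S. len (w \<otimes> s) < len w}"

lemma desc_S: "s \<in> desc w \<Longrightarrow> s \<in> S" by (simp add: desc_def)

lemma len_mult_gen_ne:
  assumes "w \<in> carrier W" "s \<in> S" shows "len (w \<otimes> s) \<noteq> len w"
proof
  assume eq: "len (w \<otimes> s) = len w"
  obtain ws where ws: "ws \<in> lists S" "wp ws = w" "length ws = len w"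
    using reduced_exists[OF assms(1)] by metis
  obtain vs where vs: "vs \<in> lists S" "wp vs = w \<otimes> s" "length vs = len (w \<otimes> s)"
    using reduced_exists[of "w \<otimes> s"] assms by (metis S_carrier m_closed)
  have l: "ws @ [s] \<in> lists S" using ws(1) assms(2) by simp
  have "wp (ws @ [s]) = wp ws \<otimes> s" using ws(1) assms(2) by simp
  then have "wp (ws @ [s]) = wp vs" unfolding ws(2) vs(2) .
  then have "even (length (ws @ [s])) = even (length vs)" by (rule parity_length[OF l vs(1)])
  then show False using ws(3) vs(3) eq by simp
qed

lemma len_desc: assumes "w \<in> carrier W" "s \<in> desc w" shows "len w = Suc (len (w \<otimes> s))"
  using assms len_mult_le[of "w \<otimes> s" s] by (simp add: desc_def)

lemma len_not_desc:
  assumes "w \<in> carrier W" "s \<in> S" "s \<notin> desc w" shows "len (w \<otimes> s) = Suc (len w)"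
  using assms len_mult_le[of w s] len_mult_gen_ne[of w s] by (simp add: desc_def)

lemma desc_mult: "w \<in> carrier W \<Longrightarrow> s \<in> S \<Longrightarrow> s \<in> desc (w \<otimes> s) \<longleftrightarrow> s \<notin> desc w"
  using len_mult_gen_ne[of w s] unfolding desc_def by simp linarith

lemma desc_ex: assumes "w \<in> carrier W" "w \<noteq> \<one>" obtains s where "s \<in> desc w"
proof -
  obtain ws where ws: "ws \<in> lists S" "wp ws = w" "length ws = len w"
    using reduced_exists[OF assms(1)] by metis
  have "ws \<noteq> []" using ws(2) assms(2) by auto
  then obtain vs s where v: "ws = vs @ [s]" using rev_exhaust by blast
  have vs: "vs \<in> lists S" "s \<in> S" using ws(1) v by simp_all
  have "w \<otimes> s = wp vs" using ws(2) vs unfolding v by auto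
  then have "len (w \<otimes> s) < len w" using len_le[OF vs(1)] ws(3) v by simp
  then have "s \<in> desc w" using vs by (simp add: desc_def)
  then show thesis by (rule that)
qed

lemma desc_one [simp]: "desc \<one> = {}" by (auto simp: desc_def)

text \<open>
  A reduced word of the element that ends in the descent \<open>s\<close> contains \<open>s\<close> exactly once among its
  reflections: otherwise a letter could be deleted. By parity, \<open>s\<close> then occurs among the reflections
  of every word of the element.
\<close>

lemma desc_in_reflections:
  assumes "ws \<in> lists S" "s \<in> desc (wp ws)" shows "s \<in> set (reflections ws)"
proof -
  have s: "s \<in> S" using assms by (simp add: desc_S)
  obtain vs where vs: "vs \<in> lists S" "wp vs = wp ws \<otimes> s" "length vs = len (wp ws \<otimes> s)"
    using reduced_exists[of "wp ws \<otimes> s"] assms s by (metis S_carrier m_closed wp_closed)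
  have v': "wp (vs @ [s]) = wp ws" using vs s assms by auto
  have ld: "len (wp ws) = Suc (length vs)" using len_desc assms vs by simp
  have "s \<notin> set (map (\<lambda>r. inv (wp [s]) \<otimes> r \<otimes> wp [s]) (reflections vs))"
  proof
    assume "s \<in> set (map (\<lambda>r. inv (wp [s]) \<otimes> r \<otimes> wp [s]) (reflections vs))"
    then obtain r where r: "r \<in> set (reflections vs)" and e: "s = inv (wp [s]) \<otimes> r \<otimes> wp [s]"
      unfolding set_map by blast
    have rc: "r \<in> carrier W" using reflections_closed[OF vs(1) r] .
    have "s \<otimes> r \<otimes> s = s" using e[symmetric] s by simp
    then have "r = s" using s rc
      by (metis S_carrier S_sq S_sq_cancel S_sq_cancel_right l_one m_closed)
    then have "s \<in> set (reflections vs)" using r by simp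
    from reflections_delete[OF vs(1) this] obtain p x q where
      "vs = p @ x # q" "wp vs \<otimes> s = wp (p @ q)" "p @ q \<in> lists S" by (metis append_in_lists_conv wp_append)
    moreover have "wp vs \<otimes> s = wp ws" using vs s assms by simp
    ultimately show False using ld len_le[of "p @ q"] by simp
  qed
  then have "count_list (reflections (vs @ [s])) s = 1"
    using reflections_append[of vs "[s]"] vs s by (simp add: count_list_0_iff)
  then have "odd (count_list (reflections ws) s)"
    using parity_reflections[of "vs @ [s]" ws s] vs s assms v' by auto
  then show ?thesis by (metis count_list_0_iff even_zero)
qed

lemma exchange:
  assumes "ws \<in> lists S" "s \<in> desc (wp ws)"
  obtains p x q where "ws = p @ x # q" "wp ws \<otimes> s = wp p \<otimes> wp q" "p \<in> lists S" "x \<in> S" "q \<in> lists S"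
proof -
  from reflections_delete[OF assms(1) desc_in_reflections[OF assms]] obtain p x q where
    "ws = p @ x # q" "wp ws \<otimes> s = wp p \<otimes> wp q" "p \<in> lists S" "x \<in> S" "q \<in> lists S" .
  then show thesis by (rule that)
qed

text \<open>
  The folding condition: exchange in a reduced word of \<open>s \<otimes> v\<close> that starts with \<open>s\<close> cannot delete a
  letter of \<open>v\<close>, as \<open>u\<close> is not a descent of \<open>v\<close>, so it deletes \<open>s\<close>.
\<close>

lemma folding:
  assumes v: "v \<in> carrier W" and s: "s \<in> S" and u: "u \<in> S" "u \<notin> desc v" "u \<in> desc (s \<otimes> v)"
  shows "s \<otimes> v = v \<otimes> u"
proof -
  obtain vs where vs: "vs \<in> lists S" "wp vs = v" "length vs = len v"
    using reduced_exists[OF v] by metis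
  have ws: "s # vs \<in> lists S" "wp (s # vs) = s \<otimes> v" using vs s by simp_all
  have "u \<in> desc (wp (s # vs))" using ws u by simp
  from exchange[OF ws(1) this] obtain p x q where pq: "s # vs = p @ x # q"
      "wp (s # vs) \<otimes> u = wp p \<otimes> wp q" "p \<in> lists S" "x \<in> S" "q \<in> lists S" .
  have svu: "s \<otimes> v \<otimes> u = wp (p @ q)" using pq ws(2) by simp
  show ?thesis
  proof (cases p)
    case Nil
    then have "s \<otimes> v \<otimes> u = v" using svu pq(1) vs(2) by simp
    then show ?thesis using s u v by (metis S_carrier S_sq_cancel_right m_closed)
  next
    case (Cons a p')
    then have p': "vs = p' @ x # q" "a = s" "p' @ q \<in> lists S" using pq by auto
    have "s \<otimes> (v \<otimes> u) = s \<otimes> wp (p' @ q)"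
      using svu Cons p'(2,3) s u v by (simp add: m_assoc del: wp_append)
    then have "v \<otimes> u = wp (p' @ q)" using s u v p'(3) by (metis S_carrier S_sq_cancel m_closed wp_closed)
    then have "len (v \<otimes> u) < len v" using len_le[OF p'(3)] p'(1) vs(3) by simp
    then show ?thesis using u by (simp add: desc_def)
  qed
qed

lemma desc_flip:
  assumes v: "v \<in> carrier W" and s: "s \<in> S" and u: "u \<in> S"
  shows "(u \<in> desc (s \<otimes> v)) \<noteq> (u \<in> desc v) \<longleftrightarrow> s \<otimes> v = v \<otimes> u"
proof
  assume "s \<otimes> v = v \<otimes> u" then show "(u \<in> desc (s \<otimes> v)) \<noteq> (u \<in> desc v)"
    using desc_mult[OF v u] by simp
next
  assume ne: "(u \<in> desc (s \<otimes> v)) \<noteq> (u \<in> desc v)"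
  show "s \<otimes> v = v \<otimes> u"
  proof (cases "u \<in> desc v")
    case True
    then have "u \<notin> desc (s \<otimes> v)" "u \<in> desc (s \<otimes> (s \<otimes> v))" using ne v s by simp_all
    from folding[OF _ s u this] v s have "s \<otimes> (s \<otimes> v) = s \<otimes> v \<otimes> u" by blast
    then have "v = s \<otimes> v \<otimes> u" unfolding S_sq_cancel[OF s v] .
    then have "s \<otimes> v = s \<otimes> (s \<otimes> v \<otimes> u)" by (rule arg_cong)
    also have "\<dots> = v \<otimes> u" using v s u by (simp add: m_assoc)
    finally show ?thesis .
  qed (use folding ne v s u in blast)
qed

text \<open>
  Recursion from the right, because descents are read off the last letter, here \<open>x\<close>.
\<close>

fun alternating :: "'w \<Rightarrow> 'w \<Rightarrow> nat \<Rightarrow> 'w list" where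
  "alternating x z 0 = []"
| "alternating x z (Suc n) = alternating z x n @ [x]"

lemma alternating_lists [simp]: "x \<in> S \<Longrightarrow> z \<in> S \<Longrightarrow> alternating x z n \<in> lists S"
  by (induction n arbitrary: x z) auto

lemma alternating_step:
  assumes "x \<in> S" "z \<in> S" "y \<in> {x, z}"
  shows "\<exists>m. wp (alternating x z n) \<otimes> y = wp (alternating x z m) \<or> wp (alternating x z n) \<otimes> y = wp (alternating z x m)"
proof (cases n)
  case 0
  then have "wp (alternating x z n) \<otimes> y = wp (alternating y (if y = x then z else x) 1)" using assms by auto
  then show ?thesis using assms(3) by (metis empty_iff insert_iff)
next
  case (Suc k)
  show ?thesis
  proof (cases "y = x")
    case True
    then have "wp (alternating x z n) \<otimes> y = wp (alternating z x k)" using Suc assms by simp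
    then show ?thesis by blast
  next
    case False
    then have "wp (alternating x z n) \<otimes> y = wp (alternating z x (Suc n))" using assms by simp
    then show ?thesis by blast
  qed
qed

lemma reflections_alternating:
  assumes "x \<in> S" "z \<in> S" "r \<in> set (reflections (alternating x z n))"
  shows "\<exists>j::nat. r = (x \<otimes> z) [^] j \<otimes> x"
  using assms
proof (induction n arbitrary: x z r)
  case (Suc n)
  have xz: "x \<in> S" "z \<in> S" using Suc.prems by auto
  have sw: "x \<otimes> (z \<otimes> x) [^] j = (x \<otimes> z) [^] j \<otimes> x" for j :: nat
  proof (induction j)
    case (Suc j)
    have "x \<otimes> (z \<otimes> x) [^] Suc j = (x \<otimes> (z \<otimes> x) [^] j) \<otimes> (z \<otimes> x)" using xz by (simp add: m_assoc)
    then show ?case unfolding Suc using xz by (simp add: m_assoc)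
  qed (use xz in simp)
  consider "r = x" | r' where "r' \<in> set (reflections (alternating z x n))" "r = x \<otimes> r' \<otimes> x"
    using Suc.prems reflections_append[of "alternating z x n" "[x]"] by auto
  then show ?case
  proof cases
    case 1
    then show ?thesis using Suc.prems by (intro exI[of _ 0]) auto
  next
    case 2
    then obtain j :: nat where "r' = (z \<otimes> x) [^] j \<otimes> z" using Suc.IH Suc.prems by blast
    then have "r = x \<otimes> (z \<otimes> x) [^] j \<otimes> (z \<otimes> x)" using 2 Suc.prems by (simp add: m_assoc)
    also have "\<dots> = (x \<otimes> z) [^] (Suc j) \<otimes> x" using Suc.prems sw by (simp add: m_assoc)
    finally show ?thesis by blast
  qed
qed simp

text \<open>
  Write \<open>w = m \<otimes> d\<close> with \<open>d\<close> in the dihedral subgroup generated by \<open>t\<close> and \<open>u\<close>, and \<open>m\<close> of minimal length.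
  If the alternating word \<open>d\<close> ends in \<open>x\<close>, look at the other letter \<open>z\<close>, a descent of \<open>w\<close>. Its
  reflection is not crossed in \<open>m\<close> by minimality, so it is crossed in \<open>d\<close>. This gives
  \<open>z = (x \<otimes> z) [^] j \<otimes> x\<close>, so \<open>x \<otimes> z\<close> has finite order, which in a right-angled system means that
  \<open>x\<close> and \<open>z\<close> commute.
\<close>

lemma desc_commute:
  assumes w: "w \<in> carrier W" and t: "t \<in> desc w" and u: "u \<in> desc w"
  shows "t \<otimes> u = u \<otimes> t"
proof -
  have tu: "t \<in> S" "u \<in> S" using t u by (auto simp: desc_S)
  define D where "D = {wp (alternating x z n) |x z n. (x = t \<and> z = u) \<or> (x = u \<and> z = t)}"
  have D_mult: "d \<otimes> y \<in> D" if "d \<in> D" "y \<in> {t, u}" for d y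
    using that alternating_step[OF tu(1) tu(2)] alternating_step[OF tu(2) tu(1)] unfolding D_def by blast
  have Dc: "D \<subseteq> carrier W" using tu by (auto simp: D_def)
  have "\<one> \<in> D" unfolding D_def by (rule CollectI, rule exI[of _ t], rule exI[of _ u], rule exI[of _ 0]) simp
  then have "\<exists>m. m \<in> carrier W \<and> (\<exists>d\<in>D. w = m \<otimes> d)" using w by (metis r_one)
  from ex_has_least_nat[of "\<lambda>m. m \<in> carrier W \<and> (\<exists>d\<in>D. w = m \<otimes> d)" _ len] this
  obtain m d where m: "m \<in> carrier W" "d \<in> D" "w = m \<otimes> d"
    and min: "\<And>m' d'. m' \<in> carrier W \<Longrightarrow> d' \<in> D \<Longrightarrow> w = m' \<otimes> d' \<Longrightarrow> len m \<le> len m'" by metis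
  obtain ms where ms: "ms \<in> lists S" "wp ms = m" "length ms = len m"
    using reduced_exists[OF m(1)] by metis
  have key: "t \<otimes> u = u \<otimes> t"
    if xz: "x = t \<and> z = u \<or> x = u \<and> z = t" and d: "d = wp (alternating x z n)" for x z n
  proof -
    have xzS: "x \<in> S" "z \<in> S" and zd: "z \<in> desc w" using xz tu t u by auto
    have dc: "d \<in> carrier W" using m Dc by auto
    have "z \<in> set (reflections (ms @ alternating x z n))"
      using desc_in_reflections[of "ms @ alternating x z n" z] ms m d zd xzS by simp
    moreover have "z \<notin> set (map (\<lambda>r. inv d \<otimes> r \<otimes> d) (reflections ms))"
    proof
      assume "z \<in> set (map (\<lambda>r. inv d \<otimes> r \<otimes> d) (reflections ms))"
      then obtain r where r: "r \<in> set (reflections ms)" "z = inv d \<otimes> r \<otimes> d" unfolding set_map by blast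
      have rc: "r \<in> carrier W" using reflections_closed[OF ms(1) r(1)] .
      from reflections_delete[OF ms(1) r(1)] obtain p y q where
        pq: "ms = p @ y # q" "wp ms \<otimes> r = wp (p @ q)" "p @ q \<in> lists S" by (metis append_in_lists_conv wp_append)
      have "d \<otimes> z = r \<otimes> d" using r(2) rc dc by (simp add: m_assoc inv_solve_left')
      then have "(m \<otimes> r) \<otimes> d \<otimes> z = m \<otimes> (d \<otimes> z) \<otimes> z" using m(1) rc dc xzS by (simp add: m_assoc)
      also have "\<dots> = w" using m(1,3) dc xzS by (simp add: m_assoc)
      finally have "w = (m \<otimes> r) \<otimes> (d \<otimes> z)" using m rc dc xzS by (simp add: m_assoc)
      then have "len m \<le> len (m \<otimes> r)"
        using min[of "m \<otimes> r" "d \<otimes> z"] D_mult[OF m(2), of z] m(1) rc xz by auto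
      moreover have "len (m \<otimes> r) \<le> length (p @ q)" using pq ms len_le[of "p @ q"] by simp
      ultimately show False using pq ms by simp
    qed
    ultimately have "z \<in> set (reflections (alternating x z n))"
      using reflections_append[of ms "alternating x z n"] ms d xzS by auto
    then obtain j :: nat where "z = (x \<otimes> z) [^] j \<otimes> x" using reflections_alternating xzS by blast
    then have "\<one> = (x \<otimes> z) [^] j \<otimes> x \<otimes> z" using xzS by (metis S_sq)
    then have "(x \<otimes> z) [^] Suc j = \<one>" using xzS by (simp add: m_assoc)
    then have "ord (x \<otimes> z) dvd Suc j" using xzS by (meson S_carrier m_closed pow_eq_id)
    then have "ord (x \<otimes> z) \<noteq> 0" by (metis dvd_0_left_iff nat.distinct(1))
    then obtain n where "coxeter_matrix W x z = enat n" by (simp add: coxeter_matrix_def Let_def)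
    from relator_cases[OF xzS this] show ?thesis using xz by metis
  qed
  from m(2) obtain x z n where "x = t \<and> z = u \<or> x = u \<and> z = t" "d = wp (alternating x z n)"
    unfolding D_def by blast
  then show ?thesis using key by blast
qed

lemma desc_desc:
  assumes w: "w \<in> carrier W" and t: "t \<in> desc w" and u: "u \<in> desc w" and ne: "t \<noteq> u"
  shows "u \<in> desc (w \<otimes> t)"
proof (rule ccontr)
  assume nu: "u \<notin> desc (w \<otimes> t)"
  have tu: "t \<in> S" "u \<in> S" using t u by (auto simp: desc_S)
  obtain vs where vs: "vs \<in> lists S" "wp vs = w \<otimes> t" "length vs = len (w \<otimes> t)"
    using reduced_exists[of "w \<otimes> t"] w tu by (metis S_carrier m_closed)
  have ww: "wp (vs @ [t]) = w" using vs w tu by auto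
  obtain p x q where pq: "vs @ [t] = p @ x # q" "w \<otimes> u = wp p \<otimes> wp q"
      "p \<in> lists S" "x \<in> S" "q \<in> lists S"
    using exchange[of "vs @ [t]" u] vs tu u ww
    by (metis append_in_lists_conv lists.Cons lists.Nil)
  show False
  proof (cases q rule: rev_cases)
    case Nil
    then have "w \<otimes> u = w \<otimes> t" using pq vs by auto
    then show False using w tu ne by simp
  next
    case (snoc q' y)
    then have vq: "vs = p @ x # q'" "y = t" "q' \<in> lists S" using pq by auto
    have "w \<otimes> u \<otimes> t = wp (p @ q')" using pq(2,3) snoc vq tu by (simp add: m_assoc)
    then have "len (w \<otimes> u \<otimes> t) < len (w \<otimes> t)" using len_le[of "p @ q'"] pq vq vs by auto
    moreover have "w \<otimes> u \<otimes> t = w \<otimes> t \<otimes> u"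
      using desc_commute[OF w t u] w tu by (simp add: m_assoc)
    ultimately show False using nu tu by (simp add: desc_def)
  qed
qed

text \<open>
  Suppose that \<open>t\<close> is a descent of \<open>w\<close> and \<open>u\<close> is not. Then \<open>w \<otimes> u \<otimes> t = w \<otimes> t \<otimes> u\<close> is at most as long as \<open>w\<close>, and
  so shorter than \<open>w \<otimes> u\<close>.
\<close>

lemma desc_mult_commute:
  assumes w: "w \<in> carrier W" and tu: "t \<in> S" "u \<in> S" "t \<noteq> u" "t \<otimes> u = u \<otimes> t"
  shows "t \<in> desc (w \<otimes> u) \<longleftrightarrow> t \<in> desc w"
proof -
  have imp: "t \<in> desc (w \<otimes> u)" if w: "w \<in> carrier W" and "t \<in> desc w" for w
  proof (cases "u \<in> desc w")
    case True
    then show ?thesis using desc_desc[OF w True \<open>t \<in> desc w\<close>] tu by simp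
  next
    case False
    have "w \<otimes> u \<otimes> t = w \<otimes> t \<otimes> u" using w tu by (simp add: m_assoc)
    then have "len (w \<otimes> u \<otimes> t) \<le> len (w \<otimes> t) + 1" using len_mult_le[of "w \<otimes> t" u] w tu by simp
    also have "\<dots> = len w" using len_desc[OF w \<open>t \<in> desc w\<close>] by simp
    also have "\<dots> < len (w \<otimes> u)" using len_not_desc[OF w tu(2) False] by simp
    finally show ?thesis using tu by (simp add: desc_def)
  qed
  show ?thesis using imp[OF w] imp[of "w \<otimes> u"] w tu by auto
qed

text \<open>
  Usually written \<open>t\<^sup>\<bottom>\<close>.
\<close>

definition perp :: "'w \<Rightarrow> 'w set" where
  "perp t = {u \<in> S. u \<noteq> t \<and> t \<otimes> u = u \<otimes> t}"

lemma perp_S: "u \<in> perp t \<Longrightarrow> u \<in> S" by (simp add: perp_def)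
lemma perp_lists: "k \<in> lists (perp t) \<Longrightarrow> k \<in> lists S"
  by (auto simp: in_lists_conv_set perp_S)

lemma desc_perp:
  assumes "w \<in> carrier W" "t \<in> S" "k \<in> lists (perp t)"
  shows "t \<in> desc (w \<otimes> wp k) \<longleftrightarrow> t \<in> desc w"
  using assms
proof (induction k arbitrary: w)
  case (Cons u k)
  then have u: "u \<in> S" "u \<noteq> t" "t \<otimes> u = u \<otimes> t" and k: "k \<in> lists S" using perp_lists by (auto simp: perp_def)
  have "w \<otimes> wp (u # k) = (w \<otimes> u) \<otimes> wp k" using u k Cons.prems by (simp add: m_assoc)
  then show ?case using Cons.IH[of "w \<otimes> u"] Cons.prems u desc_mult_commute[of w t u] by auto
qed simp

text \<open>
  The parity of the number of letters \<open>t\<close> separates \<open>t\<close> from the subgroup generated by \<open>t\<^sup>\<bottom>\<close>.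
\<close>

lemma perp_not_gen: "t \<in> S \<Longrightarrow> k \<in> lists (perp t) \<Longrightarrow> wp k \<noteq> t"
proof
  assume t: "t \<in> S" and k: "k \<in> lists (perp t)" and eq: "wp k = t"
  have "count_list k t = 0" using k by (auto simp: perp_def count_list_0_iff in_lists_conv_set)
  then show False using parity_letter[of k "[t]" t] perp_lists[OF k] t eq by simp
qed

end

section \<open>Panels and residues of right-angled buildings\<close>

locale ra_building = ra_coxeter W S for W :: "'w monoid" (structure) and S +
  fixes \<Delta> :: "('c, 'w) building"
  assumes bld: "right_angled_building W S \<Delta>"
begin

abbreviation "C \<equiv> chambers \<Delta>"
abbreviation "\<delta> \<equiv> weyl_dist \<Delta>"

lemma adjD:
  assumes "adj \<Delta> t x y"
  shows "t \<in> S" "x \<in> C" "y \<in> C" "x \<noteq> y" "adj \<Delta> t y x"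
  using assms bld
  unfolding right_angled_building_def chamber_system_def edge_colored_graph_def by blast+

lemma dist_closed [simp]: "x \<in> C \<Longrightarrow> y \<in> C \<Longrightarrow> \<delta> x y \<in> carrier W"
  using bld unfolding right_angled_building_def by blast

lemma dist_gallery:
  "reduced_word W S ws \<Longrightarrow> x \<in> C \<Longrightarrow> y \<in> C \<Longrightarrow> \<delta> x y = wp ws \<longleftrightarrow> gallery \<Delta> x ws y"
  using bld unfolding right_angled_building_def by blast

lemma adj_trans:
  assumes "adj \<Delta> t x y" "adj \<Delta> t y z" "x \<noteq> z" shows "adj \<Delta> t x z"
proof -
  note a = adjD[OF assms(1)] adjD[OF assms(2)]
  have "z \<in> panel \<Delta> t x" "x \<in> panel \<Delta> t x"
    using a assms by (auto simp: panel_def intro: rtranclp_trans)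
  moreover have "panel \<Delta> t x \<in> panels_of_type \<Delta> t" using a by (simp add: panels_of_type_def)
  ultimately show ?thesis
    using bld a(1) assms(3) unfolding right_angled_building_def chamber_system_def by blast
qed

lemma panel_iff:
  assumes "x \<in> C" shows "y \<in> panel \<Delta> t x \<longleftrightarrow> y = x \<or> adj \<Delta> t x y"
proof
  assume "y \<in> panel \<Delta> t x"
  then have "(adj \<Delta> t)\<^sup>*\<^sup>* x y" by (simp add: panel_def)
  then show "y = x \<or> adj \<Delta> t x y"
    by (induction rule: rtranclp_induct) (use adj_trans in blast)+
qed (use assms adjD in \<open>auto simp: panel_def\<close>)

lemma reduced_gen: "t \<in> S \<Longrightarrow> reduced_word W S [t]"
  by (simp add: reduced_word_def)

lemma reduced_nil: "reduced_word W S []"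
  by (simp add: reduced_word_def)

lemma dist_adj:
  assumes "t \<in> S" "x \<in> C" "y \<in> C" shows "\<delta> x y = t \<longleftrightarrow> adj \<Delta> t x y"
proof -
  have "\<delta> x y = wp [t] \<longleftrightarrow> gallery \<Delta> x [t] y" using dist_gallery reduced_gen assms by blast
  then show ?thesis using assms adjD(3) by simp
qed

lemma dist_one_iff: "x \<in> C \<Longrightarrow> y \<in> C \<Longrightarrow> \<delta> x y = \<one> \<longleftrightarrow> x = y"
  using dist_gallery[OF reduced_nil, of x y] by simp

lemma dist_refl [simp]: "x \<in> C \<Longrightarrow> \<delta> x x = \<one>"
  using dist_one_iff by blast

lemma gallery_chambers: "gallery \<Delta> x ws y \<Longrightarrow> x \<in> C \<and> y \<in> C"
  by (induction ws arbitrary: x) (auto dest: adjD)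

lemma gallery_append:
  "gallery \<Delta> x (us @ vs) z \<longleftrightarrow> (\<exists>y. gallery \<Delta> x us y \<and> gallery \<Delta> y vs z)"
  by (induction us arbitrary: x) (auto dest: gallery_chambers)

lemma gallery_rev: "gallery \<Delta> x ws y \<Longrightarrow> gallery \<Delta> y (rev ws) x"
proof (induction ws arbitrary: x)
  case (Cons t ws)
  then obtain e where e: "adj \<Delta> t x e" "gallery \<Delta> e ws y" by auto
  then have "gallery \<Delta> e [t] x" using adjD[OF e(1)] by auto
  then show ?case using Cons.IH[OF e(2)] gallery_append by auto
qed simp

lemma dist_gallery_ex:
  assumes "x \<in> C" "y \<in> C"
  obtains ws where "reduced_word W S ws" "ws \<in> lists S" "length ws = len (\<delta> x y)"
    "wp ws = \<delta> x y" "gallery \<Delta> x ws y"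
proof -
  obtain ws where ws: "ws \<in> lists S" "wp ws = \<delta> x y" "length ws = len (\<delta> x y)" "reduced_word W S ws"
    using reduced_exists[OF dist_closed[OF assms]] by blast
  moreover have "gallery \<Delta> x ws y" using dist_gallery[OF ws(4) assms] ws(2) by simp
  ultimately show thesis using that by blast
qed

lemma dist_inv:
  assumes "x \<in> C" "y \<in> C" shows "\<delta> y x = inv (\<delta> x y)"
proof -
  obtain ws where ws: "ws \<in> lists S" "length ws = len (\<delta> x y)"
    "wp ws = \<delta> x y" "gallery \<Delta> x ws y" using dist_gallery_ex[OF assms] by metis
  have r: "wp (rev ws) = inv (\<delta> x y)" using wp_rev[OF ws(1)] ws(3) by simp
  have "reduced_word W S (rev ws)" unfolding reduced_word_def r
    using ws assms by (simp add: in_lists_conv_set)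
  then show ?thesis using dist_gallery gallery_rev[OF ws(4)] assms r by metis
qed

lemma dist_up:
  assumes "x \<in> C" "adj \<Delta> t y z" "t \<notin> desc (\<delta> x y)" shows "\<delta> x z = \<delta> x y \<otimes> t"
proof -
  note a = adjD[OF assms(2)]
  obtain ws where ws: "ws \<in> lists S" "length ws = len (\<delta> x y)" "wp ws = \<delta> x y" "gallery \<Delta> x ws y"
    using dist_gallery_ex[OF assms(1) a(2)] by metis
  have g: "gallery \<Delta> x (ws @ [t]) z" using ws assms a by (auto simp: gallery_append)
  have w: "wp (ws @ [t]) = \<delta> x y \<otimes> t" using ws a by simp
  have "reduced_word W S (ws @ [t])"
    unfolding reduced_word_def w using ws a len_not_desc[OF dist_closed[OF assms(1) a(2)] a(1) assms(3)]
    by simp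
  then show ?thesis using dist_gallery[OF _ assms(1) a(3)] g w by metis
qed

lemma down_ex:
  assumes "x \<in> C" "y \<in> C" "t \<in> desc (\<delta> x y)"
  obtains z where "adj \<Delta> t y z" "\<delta> x z = \<delta> x y \<otimes> t"
proof -
  have t: "t \<in> S" using assms desc_S by blast
  have c: "\<delta> x y \<otimes> t \<in> carrier W" using assms t by simp
  obtain ws where ws: "ws \<in> lists S" "wp ws = \<delta> x y \<otimes> t" "length ws = len (\<delta> x y \<otimes> t)" "reduced_word W S ws"
    using reduced_exists[OF c] by blast
  have w: "wp (ws @ [t]) = \<delta> x y" using ws t assms by simp
  have "reduced_word W S (ws @ [t])"
    unfolding reduced_word_def w using ws t len_desc[OF dist_closed[OF assms(1,2)] assms(3)] by simp
  then have "gallery \<Delta> x (ws @ [t]) y" using dist_gallery[OF _ assms(1,2)] w by metis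
  then obtain z where z: "gallery \<Delta> x ws z" "adj \<Delta> t z y" by (auto simp: gallery_append)
  then have "\<delta> x z = wp ws" using dist_gallery[OF ws(4) assms(1)] adjD[OF z(2)] by metis
  then show thesis using that z ws adjD(5) by metis
qed

lemma dist_step:
  assumes "x \<in> C" "adj \<Delta> t y z" shows "\<delta> x z = \<delta> x y \<or> \<delta> x z = \<delta> x y \<otimes> t"
proof (cases "t \<in> desc (\<delta> x y)")
  case True
  note a = adjD[OF assms(2)]
  obtain e where e: "adj \<Delta> t y e" "\<delta> x e = \<delta> x y \<otimes> t" using down_ex[OF assms(1) a(2) True] .
  show ?thesis
  proof (cases "e = z")
    case False
    then have "adj \<Delta> t e z" using adj_trans[OF adjD(5)[OF e(1)] assms(2)] by blast
    moreover have "t \<notin> desc (\<delta> x e)" unfolding e(2)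
      using desc_mult[of "\<delta> x y" t] True assms a by simp
    ultimately have "\<delta> x z = \<delta> x e \<otimes> t" using dist_up assms by blast
    then show ?thesis using e assms a by simp
  qed (use e in simp)
qed (use dist_up assms in blast)

text \<open>
  A panel has at most one chamber that is closest to \<open>x\<close>.
\<close>

lemma bottom_unique:
  assumes "x \<in> C" "adj \<Delta> t y z" "t \<notin> desc (\<delta> x y)" shows "t \<in> desc (\<delta> x z)"
  using dist_up[OF assms] desc_mult[of "\<delta> x y" t] adjD[OF assms(2)] assms by simp

lemma down_iff:
  assumes "x \<in> C" "adj \<Delta> t y z" "t \<in> desc (\<delta> x y)"
  shows "t \<notin> desc (\<delta> x z) \<longleftrightarrow> \<delta> x z = \<delta> x y \<otimes> t"
proof
  note a = adjD[OF assms(2)]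
  assume "t \<notin> desc (\<delta> x z)"
  then show "\<delta> x z = \<delta> x y \<otimes> t" using dist_step[OF assms(1,2)] assms(3) by auto
next
  note a = adjD[OF assms(2)]
  assume "\<delta> x z = \<delta> x y \<otimes> t"
  then show "t \<notin> desc (\<delta> x z)" using desc_mult[of "\<delta> x y" t] assms a by simp
qed

lemma bottom_ex:
  assumes "x \<in> C" "y \<in> C" "t \<in> S"
  obtains e where "e \<in> panel \<Delta> t y" "t \<notin> desc (\<delta> x e)"
proof (cases "t \<in> desc (\<delta> x y)")
  case True
  obtain e where e: "adj \<Delta> t y e" "\<delta> x e = \<delta> x y \<otimes> t" using down_ex[OF assms(1,2) True] .
  have "t \<notin> desc (\<delta> x e)" using down_iff[OF assms(1) e(1) True] e(2) by simp
  then show thesis using that e panel_iff assms by blast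
next
  case False
  then show thesis using that panel_iff assms by blast
qed

text \<open>
  Both \<open>tu\<close> and \<open>ut\<close> are reduced words of the same element, so the existence of a gallery of one type
  gives a gallery of the other.
\<close>

lemma square:
  assumes "adj \<Delta> t x y" "adj \<Delta> u y z" "u \<in> perp t"
  obtains y' where "adj \<Delta> u x y'" "adj \<Delta> t y' z"
proof -
  note a = adjD[OF assms(1)] adjD[OF assms(2)]
  have tu: "t \<noteq> u" "t \<otimes> u = u \<otimes> t" using assms(3) by (auto simp: perp_def)
  have "len (t \<otimes> u) = 2"
  proof -
    have "len (t \<otimes> u) \<noteq> 0" using len_0_iff[of "t \<otimes> u"] a tu
      by (metis S_carrier S_inv inv_equality m_closed inv_inv)
    moreover have "len (t \<otimes> u) \<noteq> 1" using len_mult_gen_ne[of t u] a by simp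
    moreover have "len (t \<otimes> u) \<le> 2" using len_mult_le[of t u] a by simp
    ultimately show ?thesis by linarith
  qed
  then have r: "reduced_word W S [t, u]" "reduced_word W S [u, t]"
    using a tu by (simp_all add: reduced_word_def)
  have "gallery \<Delta> x [t, u] z" using assms a by auto
  then have "\<delta> x z = wp [t, u]" using dist_gallery[OF r(1)] a by blast
  also have "\<dots> = wp [u, t]" using a tu by simp
  finally have "gallery \<Delta> x [u, t] z" using dist_gallery[OF r(2)] a by blast
  then show thesis using that by auto
qed

text \<open>
  \<open>sim t\<close> relates chambers in the same residue of type \<open>t\<^sup>\<bottom>\<close>, and \<open>par t\<close> chambers in the same residue of
  type \<open>{t} \<union> t\<^sup>\<bottom>\<close>. The \<open>t\<close>-panels of a residue of the second kind are parallel to each other; such a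
  residue is the product of any of its \<open>t\<close>-panels with a residue of the first kind
  (\<open>par_panel\<close>, \<open>sim_panel_unique\<close>).
\<close>

definition sim :: "'w \<Rightarrow> 'c \<Rightarrow> 'c \<Rightarrow> bool" where
  "sim t = (\<lambda>x y. \<exists>u\<in>perp t. adj \<Delta> u x y)\<^sup>*\<^sup>*"

definition par :: "'w \<Rightarrow> 'c \<Rightarrow> 'c \<Rightarrow> bool" where
  "par t = (\<lambda>x y. \<exists>u\<in>insert t (perp t). adj \<Delta> u x y)\<^sup>*\<^sup>*"

lemma sim_refl [simp]: "sim t x x" by (simp add: sim_def)
lemma par_refl [simp]: "par t x x" by (simp add: par_def)

lemma sim_step: "u \<in> perp t \<Longrightarrow> adj \<Delta> u x y \<Longrightarrow> sim t x y"
  by (auto simp: sim_def)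

lemma par_step: "u = t \<or> u \<in> perp t \<Longrightarrow> adj \<Delta> u x y \<Longrightarrow> par t x y"
  unfolding par_def by blast

lemma sim_trans: "sim t x y \<Longrightarrow> sim t y z \<Longrightarrow> sim t x z"
  unfolding sim_def by (rule rtranclp_trans)

lemma par_trans: "par t x y \<Longrightarrow> par t y z \<Longrightarrow> par t x z"
  unfolding par_def by (rule rtranclp_trans)

lemma sim_sym: "sim t x y \<Longrightarrow> sim t y x"
  unfolding sim_def by (rule sympD[OF symp_rtranclp]) (auto intro!: sympI dest: adjD)

lemma par_sym: "par t x y \<Longrightarrow> par t y x"
  unfolding par_def by (rule sympD[OF symp_rtranclp]) (blast intro: sympI dest: adjD)

lemma sim_par: "sim t x y \<Longrightarrow> par t x y"
  unfolding sim_def par_def by (rule rtranclp_mono[THEN predicate2D]) auto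

lemma par_chamber: "par t x y \<Longrightarrow> x \<in> C \<Longrightarrow> y \<in> C"
  unfolding par_def by (induction rule: rtranclp_induct) (auto dest: adjD)

lemma sim_dist:
  assumes "sim t x y" "x \<in> C" "c \<in> C"
  obtains k where "k \<in> lists (perp t)" "\<delta> c y = \<delta> c x \<otimes> wp k"
proof -
  have "\<exists>k\<in>lists (perp t). \<delta> c y = \<delta> c x \<otimes> wp k" using assms(1) unfolding sim_def
  proof (induction rule: rtranclp_induct)
    case base
    show ?case by (rule bexI[of _ "[]"]) (use assms in auto)
  next
    case (step y z)
    then obtain k u where k: "k \<in> lists (perp t)" "\<delta> c y = \<delta> c x \<otimes> wp k" and u: "u \<in> perp t" "adj \<Delta> u y z"
      by blast
    have kl: "k \<in> lists S" using perp_lists[OF k(1)] .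
    have "\<delta> c z = \<delta> c x \<otimes> wp k \<or> \<delta> c z = \<delta> c x \<otimes> wp (k @ [u])"
      using dist_step[OF assms(3) u(2)] k kl assms adjD(1)[OF u(2)] by (auto simp: m_assoc)
    moreover have "k @ [u] \<in> lists (perp t)" using k u by simp
    ultimately show ?case using k(1) by blast
  qed
  then show thesis using that by blast
qed

lemma sim_desc:
  assumes "sim t x y" "x \<in> C" "c \<in> C" "t \<in> S"
  shows "t \<in> desc (\<delta> c y) \<longleftrightarrow> t \<in> desc (\<delta> c x)"
proof -
  obtain k where "k \<in> lists (perp t)" "\<delta> c y = \<delta> c x \<otimes> wp k" using sim_dist[OF assms(1-3)] .
  then show ?thesis using desc_perp[of "\<delta> c x" t k] assms by simp
qed

lemma sim_panel_unique:
  assumes "x \<in> C" "p \<in> panel \<Delta> t x" "q \<in> panel \<Delta> t x" "sim t p q" "t \<in> S"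
  shows "p = q"
proof (rule ccontr)
  assume "p \<noteq> q"
  then have pq: "adj \<Delta> t p q" using assms adj_trans adjD(5) unfolding panel_iff[OF assms(1)] by metis
  then have p: "p \<in> C" "q \<in> C" using adjD by auto
  obtain k where k: "k \<in> lists (perp t)" "\<delta> p q = \<delta> p p \<otimes> wp k" using sim_dist[OF assms(4) p(1) p(1)] .
  have "wp k = t" using k(2) pq p dist_adj[OF assms(5) p] perp_lists[OF k(1)] by simp
  then show False using perp_not_gen[OF assms(5) k(1)] by blast
qed

lemma sim_transport:
  assumes "sim t p y" "adj \<Delta> t y z" obtains q where "adj \<Delta> t p q" "sim t q z"
proof -
  have "sim t y p" using sim_sym[OF assms(1)] .
  then have "\<exists>q. adj \<Delta> t p q \<and> sim t q z" unfolding sim_def[of t, THEN fun_cong, THEN fun_cong, of y p]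
  proof (induction rule: rtranclp_induct)
    case base
    then show ?case using assms(2) by auto
  next
    case (step x p)
    then obtain u q where u: "u \<in> perp t" "adj \<Delta> u p x" and q: "adj \<Delta> t x q" "sim t q z"
      using adjD(5) by metis
    have "t \<in> perp u" using u q adjD(1) by (auto simp: perp_def)
    from square[OF u(2) q(1) this] obtain q' where q': "adj \<Delta> t p q'" "adj \<Delta> u q' q" .
    then have "sim t q' z" using sim_trans[OF sim_step[OF u(1) q'(2)] q(2)] by blast
    then show ?case using q' by blast
  qed
  then show thesis using that by blast
qed

lemma par_panel:
  assumes "par t x y" "x \<in> C"
  obtains p where "p \<in> panel \<Delta> t x" "sim t p y"
proof -
  have "\<exists>p. p \<in> panel \<Delta> t x \<and> sim t p y" using assms(1) unfolding par_def
  proof (induction rule: rtranclp_induct)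
    case base
    show ?case using assms(2) by (intro exI[of _ x]) (simp add: panel_iff)
  next
    case (step y z)
    then obtain p u where p: "p \<in> panel \<Delta> t x" "sim t p y" and u: "u = t \<or> u \<in> perp t" "adj \<Delta> u y z"
      by blast
    show ?case
    proof (cases "u = t")
      case True
      then obtain q where q: "adj \<Delta> t p q" "sim t q z" using sim_transport[OF p(2)] u(2) by metis
      then have "q \<in> panel \<Delta> t x" using p(1) adj_trans unfolding panel_iff[OF assms(2)] by metis
      then show ?thesis using q by blast
    next
      case False
      then show ?thesis using u p sim_trans[OF p(2) sim_step] by blast
    qed
  qed
  then show thesis using that by blast
qed

text \<open>
  Among the residues of type \<open>t\<^sup>\<bottom>\<close> in a residue of type \<open>{t} \<union> t\<^sup>\<bottom>\<close>, exactly one is closest to \<open>c\<close>. Two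
  chambers outside of it have the same image, up to \<open>t\<^sup>\<bottom>\<close>, under the retraction centred at \<open>c\<close>.
\<close>

lemma par_dist:
  assumes "par t x y" "x \<in> C" "c \<in> C" "t \<in> desc (\<delta> c x)" "t \<in> desc (\<delta> c y)"
  obtains k where "k \<in> lists (perp t)" "\<delta> c y = \<delta> c x \<otimes> wp k"
proof -
  have t: "t \<in> S" using assms desc_S by blast
  obtain p where p: "p \<in> panel \<Delta> t x" "sim t p y" using par_panel[OF assms(1,2)] .
  have pC: "p \<in> C" using p(1) assms(2) adjD panel_iff by metis
  obtain k where k: "k \<in> lists (perp t)" "\<delta> c y = \<delta> c p \<otimes> wp k" using sim_dist[OF p(2) pC assms(3)] .
  have "t \<in> desc (\<delta> c p)" using sim_desc[OF p(2) pC assms(3) t] assms(5) by simp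
  then have "\<delta> c p = \<delta> c x"
    using p(1) dist_step[OF assms(3), of t x p] down_iff[OF assms(3), of t x p] assms(4)
    unfolding panel_iff[OF assms(2)] by blast
  then show thesis using that k by simp
qed

end

section \<open>Colourings and automorphisms\<close>

locale pointed_ra_building = ra_building W S \<Delta>
  for W :: "'w monoid" (structure) and S and \<Delta> :: "('c, 'w) building" +
  fixes c :: 'c
  assumes c_chamber [simp]: "c \<in> C"
begin

abbreviation "down x \<equiv> desc (\<delta> c x)"

text \<open>
  The \<open>t\<close>-colour of a chamber records its position in its \<open>t\<close>-panel, consistently over parallel panels;
  the panel of \<open>c\<close> serves as the set of colours, and the colour \<open>c\<close> is reserved for the chamber of the
  panel closest to \<open>c\<close>. So a chamber is determined by the types and colours along a reduced gallery
  from \<open>c\<close>, and these colours are never \<open>c\<close>.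
\<close>

definition coloring :: "('w \<Rightarrow> 'c \<Rightarrow> 'c) \<Rightarrow> bool" where
  "coloring h \<longleftrightarrow> (\<forall>t\<in>S.
     (\<forall>u\<in>perp t. \<forall>x y. adj \<Delta> u x y \<longrightarrow> h t x = h t y) \<and>
     (\<forall>x\<in>C. bij_betw (h t) (panel \<Delta> t x) (panel \<Delta> t c)) \<and>
     (\<forall>x\<in>C. h t x = c \<longleftrightarrow> t \<notin> down x))"

lemma coloring_perp: "coloring h \<Longrightarrow> u \<in> perp t \<Longrightarrow> adj \<Delta> u x y \<Longrightarrow> t \<in> S \<Longrightarrow> h t x = h t y"
  unfolding coloring_def by blast

lemma coloring_bij: "coloring h \<Longrightarrow> x \<in> C \<Longrightarrow> t \<in> S \<Longrightarrow> bij_betw (h t) (panel \<Delta> t x) (panel \<Delta> t c)"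
  unfolding coloring_def by blast

lemma coloring_base: "coloring h \<Longrightarrow> x \<in> C \<Longrightarrow> t \<in> S \<Longrightarrow> h t x = c \<longleftrightarrow> t \<notin> down x"
  unfolding coloring_def by blast

lemma coloring_inj:
  assumes "coloring h" "adj \<Delta> t x y" "adj \<Delta> t x z" "h t y = h t z" shows "y = z"
proof -
  note a = adjD[OF assms(2)]
  have "inj_on (h t) (panel \<Delta> t x)" using coloring_bij[OF assms(1) a(2,1)] by (simp add: bij_betw_def)
  moreover have "y \<in> panel \<Delta> t x" "z \<in> panel \<Delta> t x" using assms a panel_iff by auto
  ultimately show ?thesis using assms(4) by (meson inj_onD)
qed

lemma coloring_lift:
  assumes h: "coloring h" "coloring h'" and y: "adj \<Delta> t x y" "t \<in> down y"
    and x': "x' \<in> C" "t \<notin> down x'"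
  obtains y' where "adj \<Delta> t x' y'" "h t y = h' t y'"
proof -
  note a = adjD[OF y(1)]
  have "h t y \<in> panel \<Delta> t c"
    using coloring_bij[OF h(1) a(2) a(1)] y panel_iff[OF a(2)] by (auto simp: bij_betw_def)
  then obtain y' where y': "y' \<in> panel \<Delta> t x'" "h t y = h' t y'"
    using coloring_bij[OF h(2) x'(1) a(1)] by (auto simp: bij_betw_def)
  have "h t y \<noteq> c" using coloring_base[OF h(1) a(3) a(1)] y by simp
  moreover have "h' t x' = c" using coloring_base[OF h(2) x'(1) a(1)] x' by simp
  ultimately have "y' \<noteq> x'" using y' by auto
  then show thesis using that y' panel_iff x' by blast
qed

text \<open>
  Following from \<open>c\<close> a reduced gallery with prescribed types and colours, read by \<open>h\<close> on the left and
  by \<open>h'\<close> on the right. As a relation this is symmetric in the two colourings, so that existence and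
  uniqueness of the image also give existence and uniqueness of the preimage.
\<close>

inductive transport :: "('w \<Rightarrow> 'c \<Rightarrow> 'c) \<Rightarrow> ('w \<Rightarrow> 'c \<Rightarrow> 'c) \<Rightarrow> 'c \<Rightarrow> 'c \<Rightarrow> bool" for h h' where
  base: "transport h h' c c"
| step: "\<lbrakk>transport h h' x x'; adj \<Delta> t x y; t \<notin> down x; adj \<Delta> t x' y'; h t y = h' t y'\<rbrakk>
    \<Longrightarrow> transport h h' y y'"

lemma transport_dist: "transport h h' x x' \<Longrightarrow> x \<in> C \<and> x' \<in> C \<and> \<delta> c x' = \<delta> c x"
proof (induction rule: transport.induct)
  case (step x x' t y y')
  have "\<delta> c y = \<delta> c x \<otimes> t" using dist_up[OF c_chamber step.hyps(2,3)] .
  moreover have "\<delta> c y' = \<delta> c x' \<otimes> t"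
    using dist_up[OF c_chamber step.hyps(4)] step.hyps(3) step.IH by metis
  ultimately show ?case using step adjD by metis
qed simp

lemma transport_sym: "transport h h' x x' \<Longrightarrow> transport h' h x' x"
proof (induction rule: transport.induct)
  case (step x x' t y y')
  have "t \<notin> down x'" using step.hyps(3) transport_dist[OF step.hyps(1)] by simp
  then show ?case using transport.step[OF step.IH step.hyps(4) _ step.hyps(2)] step.hyps(5) by simp
qed (rule transport.base)

lemma len_lt: "x \<in> C \<Longrightarrow> adj \<Delta> t x y \<Longrightarrow> t \<notin> down x \<Longrightarrow> len (\<delta> c x) < len (\<delta> c y)"
  using dist_up[OF c_chamber, of t x y] len_not_desc[of "\<delta> c x" t] adjD[of t x y] by simp

lemma transport_ex:
  assumes h: "coloring h" "coloring h'" and "y \<in> C" shows "\<exists>y'. transport h h' y y'"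
  using assms(3)
proof (induction "len (\<delta> c y)" arbitrary: y rule: less_induct)
  case less
  show ?case
  proof (cases "y = c")
    case False
    then have "\<delta> c y \<noteq> \<one>" using dist_one_iff less.prems by auto
    then obtain t where t: "t \<in> down y" using desc_ex dist_closed[OF c_chamber less.prems] by metis
    obtain x where x: "adj \<Delta> t y x" "\<delta> c x = \<delta> c y \<otimes> t" using down_ex[OF c_chamber less.prems t] .
    have nx: "t \<notin> down x" using down_iff[OF c_chamber x(1) t] x(2) by simp
    note a = adjD[OF x(1)]
    obtain x' where x': "transport h h' x x'" using less.hyps[OF len_lt[OF a(3,5) nx] a(3)] by blast
    have d: "x' \<in> C" "t \<notin> down x'" using transport_dist[OF x'] nx by auto
    obtain y' where "adj \<Delta> t x' y'" "h t y = h' t y'" using coloring_lift[OF h a(5) t d] .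
    then show ?thesis using transport.step[OF x' a(5) nx] by blast
  qed (use transport.base in blast)
qed

text \<open>
  Induction on the distance from \<open>c\<close>. Suppose that \<open>y\<close> is reached from \<open>x1\<close> and \<open>x2\<close> by steps of
  different types \<open>t1\<close> and \<open>t2\<close>. Both are descents, so they commute, and \<open>y\<close>, \<open>x1\<close>, \<open>x2\<close> span a square with
  a bottom chamber \<open>z\<close>. Transporting \<open>z\<close> and completing the square on the other side shows, since
  colours agree on parallel panels, that both ways around the square end in the same chamber.
\<close>

lemma transport_unique:
  assumes h: "coloring h" "coloring h'" and "transport h h' y y1" "transport h h' y y2"
  shows "y1 = y2"
  using assms(3,4)
proof (induction "len (\<delta> c y)" arbitrary: y y1 y2 rule: less_induct)
  case less
  have yC: "y \<in> C" using transport_dist less.prems by blast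
  show ?case
  proof (cases "y = c")
    case True
    then have "\<delta> c y1 = \<one>" "\<delta> c y2 = \<one>" "y1 \<in> C" "y2 \<in> C"
      using transport_dist[OF less.prems(1)] transport_dist[OF less.prems(2)] by auto
    then show ?thesis using dist_one_iff by (metis c_chamber)
  next
    case False
    obtain t1 x1 x1' where 1: "transport h h' x1 x1'" "adj \<Delta> t1 x1 y" "t1 \<notin> down x1"
        "adj \<Delta> t1 x1' y1" "h t1 y = h' t1 y1"
      using less.prems(1) False by (cases rule: transport.cases) auto
    obtain t2 x2 x2' where 2: "transport h h' x2 x2'" "adj \<Delta> t2 x2 y" "t2 \<notin> down x2"
        "adj \<Delta> t2 x2' y2" "h t2 y = h' t2 y2"
      using less.prems(2) False by (cases rule: transport.cases) auto
    note a1 = adjD[OF 1(2)] and a2 = adjD[OF 2(2)]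
    have t1: "t1 \<in> down y" using bottom_unique[OF c_chamber 1(2,3)] .
    have t2: "t2 \<in> down y" using bottom_unique[OF c_chamber 2(2,3)] .
    have IH1: "transport h h' x1 u \<Longrightarrow> u = x1'" for u using less.hyps[OF len_lt[OF a1(2) 1(2,3)]] 1(1) by blast
    have IH2: "transport h h' x2 u \<Longrightarrow> u = x2'" for u using less.hyps[OF len_lt[OF a2(2) 2(2,3)]] 2(1) by blast
    show ?thesis
    proof (cases "t1 = t2")
      case True
      have "x1 = x2"
      proof (rule ccontr)
        assume "x1 \<noteq> x2"
        then have "adj \<Delta> t1 x1 x2" using adj_trans[OF 1(2)] a2(5) True by blast
        then show False using bottom_unique[OF c_chamber] 1(3) 2(3) True by blast
      qed
      then have "x1' = x2'" using IH1 2(1) by blast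
      then show ?thesis using coloring_inj[OF h(2) 1(4)] 2(4,5) 1(5) True by metis
    next
      case False
      have yW: "\<delta> c y \<in> carrier W" using yC by simp
      have comm: "t1 \<otimes> t2 = t2 \<otimes> t1" using desc_commute[OF yW t1 t2] .
      have p12: "t2 \<in> perp t1" "t1 \<in> perp t2" using False comm a1(1) a2(1) by (auto simp: perp_def)
      have dx1: "\<delta> c x1 = \<delta> c y \<otimes> t1" using down_iff[OF c_chamber a1(5) t1] 1(3) by simp
      have "t2 \<in> down x1" using desc_desc[OF yW t1 t2 False] dx1 by simp
      then obtain z where z: "adj \<Delta> t2 x1 z" "\<delta> c z = \<delta> c x1 \<otimes> t2" "t2 \<notin> down z"
        using down_ex[OF c_chamber a1(2)] down_iff[OF c_chamber] by metis
      note az = adjD[OF z(1)]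
      obtain q where q: "adj \<Delta> t1 z q" "adj \<Delta> t2 q y" using square[OF az(5) 1(2) p12(2)] .
      have nz: "t1 \<notin> down z"
        using sim_desc[OF sim_step[OF p12(1) z(1)] a1(2) c_chamber a1(1)] 1(3) by simp
      have nq: "t2 \<notin> down q"
        using sim_desc[OF sim_step[OF p12(2) q(1)] az(3) c_chamber a2(1)] z(3) by simp
      have qx2: "q = x2"
      proof (rule ccontr)
        assume "q \<noteq> x2"
        then have "adj \<Delta> t2 q x2" using adj_trans[OF q(2) a2(5)] by blast
        then show False using bottom_unique[OF c_chamber] nq 2(3) by blast
      qed
      obtain z' where z': "transport h h' z z'" using transport_ex[OF h az(3)] by blast
      have zC: "z' \<in> C" "t2 \<notin> down z'" "t1 \<notin> down z'" using transport_dist[OF z'] z(3) nz by auto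
      obtain v where v: "adj \<Delta> t2 z' v" "h t2 x1 = h' t2 v"
        using coloring_lift[OF h az(5) \<open>t2 \<in> down x1\<close> zC(1,2)] .
      have "v = x1'" using IH1 transport.step[OF z' az(5) z(3) v] by blast
      then have zx1: "adj \<Delta> t2 z' x1'" "h t2 x1 = h' t2 x1'" using v by auto
      obtain q' where q': "adj \<Delta> t1 z' q'" "adj \<Delta> t2 q' y1" using square[OF zx1(1) 1(4) p12(2)] .
      have "h t1 q = h t1 y" using coloring_perp[OF h(1) p12(1) q(2) a1(1)] .
      also have "\<dots> = h' t1 q'" using 1(5) coloring_perp[OF h(2) p12(1) q'(2) a1(1)] by simp
      finally have "q' = x2'" using IH2 transport.step[OF z' q(1) nz q'(1)] qx2 by blast
      then have "adj \<Delta> t2 x2' y1" using q' by simp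
      moreover have "h' t2 y1 = h' t2 y2"
        using coloring_perp[OF h(2) p12(2) 1(4) a2(1)] zx1(2)
          coloring_perp[OF h(1) p12(2) 1(2) a2(1)] 2(5) by simp
      ultimately show ?thesis using coloring_inj[OF h(2) _ 2(4)] by blast
    qed
  qed
qed

lemma transport_color:
  assumes h: "coloring h" "coloring h'" and "transport h h' y y'" "t \<in> down y"
  shows "h t y = h' t y'"
proof -
  have y: "y \<in> C" using transport_dist assms by blast
  obtain x where x: "adj \<Delta> t y x" "\<delta> c x = \<delta> c y \<otimes> t" using down_ex[OF c_chamber y assms(4)] .
  have nx: "t \<notin> down x" using down_iff[OF c_chamber x(1) assms(4)] x(2) by simp
  note a = adjD[OF x(1)]
  obtain x' where x': "transport h h' x x'" using transport_ex[OF h a(3)] by blast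
  have d: "x' \<in> C" "t \<notin> down x'" using transport_dist[OF x'] nx by auto
  obtain z where z: "adj \<Delta> t x' z" "h t y = h' t z" using coloring_lift[OF h a(5) assms(4) d] .
  then have "z = y'" using transport_unique[OF h transport.step[OF x' a(5) nx z]] assms by blast
  then show ?thesis using z by simp
qed

lemma transport_adj:
  assumes h: "coloring h" "coloring h'" and T: "transport h h' y y'" "transport h h' z z'"
    and yz: "adj \<Delta> t y z"
  shows "adj \<Delta> t y' z'"
proof -
  have up: "adj \<Delta> t y' z'" if T: "transport h h' y y'" "transport h h' z z'" and yz: "adj \<Delta> t y z"
    and n: "t \<notin> down y" for y y' z z'
  proof -
    have tz: "t \<in> down z" using bottom_unique[OF c_chamber yz n] .
    have d: "y' \<in> C" "t \<notin> down y'" using transport_dist[OF T(1)] n by auto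
    obtain v where v: "adj \<Delta> t y' v" "h t z = h' t v" using coloring_lift[OF h yz tz d] .
    then have "v = z'" using transport_unique[OF h transport.step[OF T(1) yz n v]] T by blast
    then show ?thesis using v by simp
  qed
  note a = adjD[OF yz]
  consider "t \<notin> down y" | "t \<notin> down z" | "t \<in> down y" "t \<in> down z" by blast
  then show ?thesis
  proof cases
    case 1 then show ?thesis using up T yz by blast
  next
    case 2 then show ?thesis using up[OF T(2,1) a(5)] adjD(5) by blast
  next
    case 3
    obtain x where x: "adj \<Delta> t y x" "\<delta> c x = \<delta> c y \<otimes> t" using down_ex[OF c_chamber a(2) 3(1)] .
    have nx: "t \<notin> down x" using down_iff[OF c_chamber x(1) 3(1)] x(2) by simp
    note ax = adjD[OF x(1)]
    have "x \<noteq> z" using nx 3 by auto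
    then have xz: "adj \<Delta> t x z" using adj_trans[OF ax(5) yz] by blast
    obtain x' where x': "transport h h' x x'" using transport_ex[OF h ax(3)] by blast
    have e: "adj \<Delta> t x' y'" "adj \<Delta> t x' z'" using up[OF x' T(1) ax(5) nx] up[OF x' T(2) xz nx] .
    have "y' \<noteq> z'"
    proof
      assume "y' = z'"
      then have "h t y = h t z" using transport_color[OF h T(1) 3(1)] transport_color[OF h T(2) 3(2)] by simp
      then show False using coloring_inj[OF h(1) ax(5) xz] a(4) by blast
    qed
    then show ?thesis using adj_trans[OF adjD(5)[OF e(1)] e(2)] by blast
  qed
qed

lemma coloring_automorphism:
  assumes h: "coloring h" "coloring h'"
  obtains g where "g \<in> carrier (Aut S \<Delta>)" "\<And>x y. transport h h' x y \<Longrightarrow> g x = y"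
proof -
  define g where "g = (\<lambda>x\<in>C. THE y. transport h h' x y)"
  have g: "g x = y" if "transport h h' x y" for x y
    using that transport_dist[OF that] transport_unique[OF h] unfolding g_def by auto
  have T: "transport h h' x (g x)" if "x \<in> C" for x
    using transport_ex[OF h that] g by metis
  have "bij_betw g C C"
  proof (intro bij_betwI')
    fix x y assume "x \<in> C" "y \<in> C"
    then have "transport h' h (g x) x" "transport h' h (g y) y" using T transport_sym by blast+
    then show "g x = g y \<longleftrightarrow> x = y" using transport_unique[OF h(2,1)] by metis
  next
    fix x assume "x \<in> C" then show "g x \<in> C" using T transport_dist by blast
  next
    fix y assume "y \<in> C"
    then obtain x where "transport h' h y x" using transport_ex[OF h(2,1)] by blast
    then have "transport h h' x y" using transport_sym by blast
    then show "\<exists>x\<in>C. y = g x" using g transport_dist by blast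
  qed
  then have "g \<in> Bij C" by (simp add: Bij_def g_def)
  moreover have "adj \<Delta> t (g x) (g y) \<longleftrightarrow> adj \<Delta> t x y" if "x \<in> C" "y \<in> C" for t x y
    using transport_adj[OF h T[OF that(1)] T[OF that(2)]]
      transport_adj[OF h(2,1) transport_sym[OF T[OF that(1)]] transport_sym[OF T[OF that(2)]]] by blast
  ultimately have "g \<in> carrier (Aut S \<Delta>)" by (simp add: Aut_def)
  then show thesis using that g by blast
qed

text \<open>
  The conditions on a \<open>t\<close>-colouring of a single residue \<open>R\<close> of type \<open>{t} \<union> t\<^sup>\<bottom>\<close>, with the extra demand that
  the chambers of \<open>M\<close> get the colour \<open>p t\<close>.
\<close>

definition good_color :: "('w \<Rightarrow> 'c) \<Rightarrow> 'w \<Rightarrow> 'c set \<Rightarrow> 'c set \<Rightarrow> ('c \<Rightarrow> 'c) \<Rightarrow> bool" where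
  "good_color p t R M f \<longleftrightarrow>
     (\<forall>x\<in>R. (\<forall>u\<in>perp t. \<forall>y. adj \<Delta> u x y \<longrightarrow> f x = f y) \<and>
        bij_betw f (panel \<Delta> t x) (panel \<Delta> t c) \<and> (f x = c \<longleftrightarrow> t \<notin> down x) \<and> (x \<in> M \<longrightarrow> f x = p t))"

definition marked_class :: "('w \<Rightarrow> 'c set) \<Rightarrow> 'w \<Rightarrow> 'c \<Rightarrow> 'c set" where
  "marked_class M t x = {y. par t x y \<and> (\<exists>m\<in>M t. sim t m y)}"

text \<open>
  The choice is made once for each residue and depends on nothing but the residue and its marked
  chambers. Two families of marks that agree on a residue therefore give the same colours on it
  (\<open>std_coloring_cong\<close>), which is what makes the automorphism between them fix chambers there.
\<close>

definition std_coloring :: "('w \<Rightarrow> 'c) \<Rightarrow> ('w \<Rightarrow> 'c set) \<Rightarrow> 'w \<Rightarrow> 'c \<Rightarrow> 'c" where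
  "std_coloring p M t x = (SOME f. good_color p t {y. par t x y} (marked_class M t x) f) x"

lemma bij_two_points:
  assumes "P \<approx> Q" "e \<in> P" "e' \<in> Q" "a \<in> P" "a' \<in> Q" "a \<noteq> e" "a' \<noteq> e'"
  obtains f where "bij_betw f P Q" "f e = e'" "f a = a'"
proof -
  obtain f where f: "bij_betw f P Q" using assms(1) by (auto simp: eqpoll_def)
  define f1 where "f1 = Transposition.transpose (f e) e' \<circ> f"
  have b: "bij_betw (Transposition.transpose u v \<circ> k) P Q"
    if "bij_betw k P Q" "u \<in> Q" "v \<in> Q" for k u v
    using that by (intro bij_betw_trans[OF that(1)]) (simp add: bij_betw_transpose_iff)
  have f1: "bij_betw f1 P Q" "f1 e = e'"
    using b[OF f, of "f e" e'] assms f by (auto simp: f1_def bij_betw_apply)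
  define f2 where "f2 = Transposition.transpose (f1 a) a' \<circ> f1"
  have ne: "f1 a \<noteq> e'" using f1 assms by (metis bij_betw_def inj_onD)
  have "bij_betw f2 P Q" "f2 e = e'" "f2 a = a'"
    using b[OF f1(1), of "f1 a" a'] assms f1 ne
    by (auto simp: f2_def bij_betw_apply Transposition.transpose_def)
  then show thesis using that by blast
qed

text \<open>
  Choose a bijection from one \<open>t\<close>-panel \<open>P\<close> of the residue to the colours and extend it along the
  residues of type \<open>t\<^sup>\<bottom>\<close>, each of which meets \<open>P\<close> in one chamber. The closest chamber of \<open>P\<close> must get the
  colour \<open>c\<close>, and the marks prescribe the colour of at most one further chamber, because the marks
  in the residue are all related by \<open>sim t\<close>.
\<close>

lemma good_color_exists:
  assumes semi: "semi_regular S \<Delta>" and t: "t \<in> S" and r: "r \<in> C"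
    and p: "p t \<in> panel \<Delta> t c" "p t \<noteq> c"
    and M: "\<And>m. m \<in> M t \<Longrightarrow> m \<in> C \<and> t \<in> down m"
      "\<And>m m'. m \<in> M t \<Longrightarrow> m' \<in> M t \<Longrightarrow> par t m m' \<Longrightarrow> sim t m m'"
  shows "\<exists>f. good_color p t {y. par t r y} (marked_class M t r) f"
proof -
  define P where "P = panel \<Delta> t r"
  define \<pi> where "\<pi> y = (THE q. q \<in> P \<and> sim t q y)" for y
  have PC: "q \<in> C" if "q \<in> P" for q using that by (simp add: P_def panel_def)
  have uniq: "q = q'" if "q \<in> P" "q' \<in> P" "sim t q y" "sim t q' y" for q q' y
    using sim_panel_unique[OF r _ _ sim_trans[OF that(3) sim_sym[OF that(4)]] t] that by (simp add: P_def)
  have \<pi>: "\<pi> y \<in> P" "sim t (\<pi> y) y" if ry: "par t r y" for y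
  proof -
    from par_panel[OF ry r] obtain q where "q \<in> P" "sim t q y" unfolding P_def .
    then have "\<exists>!q. q \<in> P \<and> sim t q y" using uniq by (intro ex1I[of _ q]) auto
    from theI'[OF this] have "\<pi> y \<in> P \<and> sim t (\<pi> y) y" unfolding \<pi>_def .
    then show "\<pi> y \<in> P" "sim t (\<pi> y) y" by auto
  qed
  have \<pi>_eq: "\<pi> y = q" if "par t r y" "q \<in> P" "sim t q y" for y q
    using uniq[OF \<pi>(1)[OF that(1)] that(2) \<pi>(2)[OF that(1)] that(3)] .
  obtain e where e: "e \<in> P" "t \<notin> down e" using bottom_ex[OF c_chamber r t] unfolding P_def .
  have e_uniq: "q = e" if "q \<in> P" "t \<notin> down q" for q
  proof (rule ccontr)
    assume "q \<noteq> e"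
    then have "adj \<Delta> t q e" using that e adj_trans adjD(5) unfolding P_def panel_iff[OF r] by metis
    then show False using bottom_unique[OF c_chamber] that e by blast
  qed
  have eqp: "P \<approx> panel \<Delta> t c"
    using semi t r c_chamber unfolding semi_regular_def panels_of_type_def P_def by blast
  \<comment> \<open>If there are no marks, any second chamber of the panel will do.\<close>
  obtain a where a: "a \<in> P" "a \<noteq> e" and aM: "\<And>y. y \<in> marked_class M t r \<Longrightarrow> \<pi> y = a"
  proof (cases "marked_class M t r = {}")
    case True
    obtain f where f: "bij_betw f P (panel \<Delta> t c)" using eqp by (auto simp: eqpoll_def)
    obtain u v where "u \<in> P" "f u = p t" "v \<in> P" "f v = c"
      using p f panel_iff[OF c_chamber] by (metis bij_betw_iff_bijections)
    then have "u \<noteq> e \<or> v \<noteq> e" using p(2) by auto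
    then show ?thesis using that[of u] that[of v] \<open>u \<in> P\<close> \<open>v \<in> P\<close> True by blast
  next
    case False
    have mark: "\<exists>m\<in>M t. sim t m (\<pi> y)" "par t r y" if "y \<in> marked_class M t r" for y
      using that \<pi>(2) sim_trans sim_sym unfolding marked_class_def by blast+
    from False obtain y where y: "y \<in> marked_class M t r" by blast
    have yP: "\<pi> y \<in> P" using \<pi>(1)[OF mark(2)[OF y]] .
    obtain m where m: "m \<in> M t" "sim t m (\<pi> y)" using mark(1)[OF y] by blast
    have "t \<in> down (\<pi> y)" using sim_desc[OF m(2) _ c_chamber t] M(1)[OF m(1)] by blast
    then have "\<pi> y \<noteq> e" using e by auto
    moreover have "\<pi> y' = \<pi> y" if y': "y' \<in> marked_class M t r" for y'
    proof -
      obtain m' where m': "m' \<in> M t" "sim t m' (\<pi> y')" using mark(1)[OF y'] by blast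
      have y'P: "\<pi> y' \<in> P" using \<pi>(1)[OF mark(2)[OF y']] .
      have rP: "par t r q" if "q \<in> P" for q
        using that par_step[of t t r q] unfolding P_def panel_iff[OF r] by auto
      have "par t m m'" using sim_par[OF m(2)] sim_par[OF sim_sym[OF m'(2)]] rP[OF yP] rP[OF y'P]
        par_trans par_sym by metis
      then have "sim t m m'" using M(2) m m' by blast
      then have "sim t (\<pi> y') (\<pi> y)" using m m' sim_trans sim_sym by metis
      then show ?thesis using uniq[OF y'P yP _ sim_refl] by blast
    qed
    ultimately show ?thesis using that yP by blast
  qed
  obtain f where f: "bij_betw f P (panel \<Delta> t c)" "f e = c" "f a = p t"
    using bij_two_points[OF eqp e(1) _ a(1) p(1) a(2) p(2)] panel_iff[OF c_chamber] by blast
  have "good_color p t {y. par t r y} (marked_class M t r) (f \<circ> \<pi>)"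
    unfolding good_color_def
  proof (intro ballI conjI impI allI)
    fix x u y assume x: "x \<in> {y. par t r y}" and u: "u \<in> perp t" "adj \<Delta> u x y"
    have ry: "par t r y" using x par_trans[OF _ par_step[of u t x y]] u by blast
    have "sim t (\<pi> x) y" using sim_trans[OF \<pi>(2) sim_step[OF u]] x by blast
    then show "(f \<circ> \<pi>) x = (f \<circ> \<pi>) y" using \<pi>_eq[OF ry] \<pi>(1)[of x] x by simp
  next
    fix x assume "x \<in> {y. par t r y}"
    then have x: "par t r x" by simp
    have xC: "x \<in> C" using par_chamber[OF x r] .
    have par_x: "par t r y" if "y \<in> panel \<Delta> t x" for y
      using that x par_trans[OF x par_step[of t t x y]] unfolding panel_iff[OF xC] by auto
    have "bij_betw \<pi> (panel \<Delta> t x) P"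
    proof (intro bij_betwI')
      fix y z assume y: "y \<in> panel \<Delta> t x" and z: "z \<in> panel \<Delta> t x"
      show "\<pi> y = \<pi> z \<longleftrightarrow> y = z"
      proof
        assume eq: "\<pi> y = \<pi> z"
        have "sim t y z" using \<pi>(2)[OF par_x[OF y]] \<pi>(2)[OF par_x[OF z]] eq sim_trans sim_sym by metis
        then show "y = z" using sim_panel_unique[OF xC y z _ t] by blast
      qed simp
    next
      fix y assume "y \<in> panel \<Delta> t x" then show "\<pi> y \<in> P" using \<pi>(1) par_x by blast
    next
      fix q assume q: "q \<in> P"
      have "par t r q" using q par_step[of t t r q] unfolding P_def panel_iff[OF r] by auto
      then have "par t x q" using par_trans[OF par_sym[OF x]] by blast
      from par_panel[OF this xC] obtain y where y: "y \<in> panel \<Delta> t x" "sim t y q" .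
      then show "\<exists>y\<in>panel \<Delta> t x. q = \<pi> y" using \<pi>_eq[OF par_x q sim_sym] by metis
    qed
    then show "bij_betw (f \<circ> \<pi>) (panel \<Delta> t x) (panel \<Delta> t c)" using f(1) by (rule bij_betw_trans)
    have "(f \<circ> \<pi>) x = c \<longleftrightarrow> \<pi> x = e"
      using f e(1) \<pi>(1)[OF x] by (metis bij_betw_iff_bijections comp_apply)
    also have "\<dots> \<longleftrightarrow> t \<notin> down (\<pi> x)" using e e_uniq \<pi>(1)[OF x] by blast
    also have "\<dots> \<longleftrightarrow> t \<notin> down x" using sim_desc[OF \<pi>(2)[OF x] PC[OF \<pi>(1)[OF x]] c_chamber t] by simp
    finally show "(f \<circ> \<pi>) x = c \<longleftrightarrow> t \<notin> down x" .
    show "(f \<circ> \<pi>) x = p t" if "x \<in> marked_class M t r" using aM[OF that] f(3) by simp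
  qed
  then show ?thesis by blast
qed

lemma std_coloring:
  assumes semi: "semi_regular S \<Delta>"
    and p: "\<And>t. t \<in> S \<Longrightarrow> p t \<in> panel \<Delta> t c \<and> p t \<noteq> c"
    and M: "\<And>t m. t \<in> S \<Longrightarrow> m \<in> M t \<Longrightarrow> m \<in> C \<and> t \<in> down m"
      "\<And>t m m'. t \<in> S \<Longrightarrow> m \<in> M t \<Longrightarrow> m' \<in> M t \<Longrightarrow> par t m m' \<Longrightarrow> sim t m m'"
  shows "coloring (std_coloring p M)"
    and "\<And>t m. t \<in> S \<Longrightarrow> m \<in> M t \<Longrightarrow> std_coloring p M t m = p t"
proof -
  define f where "f t x = (SOME f. good_color p t {y. par t x y} (marked_class M t x) f)" for t x
  have good: "good_color p t {y. par t x y} (marked_class M t x) (f t x)" if "t \<in> S" "x \<in> C" for t x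
  proof -
    have "\<exists>f. good_color p t {y. par t x y} (marked_class M t x) f"
      by (rule good_color_exists) (use that semi p M in auto)
    from someI_ex[OF this] show ?thesis unfolding f_def .
  qed
  have std: "std_coloring p M t x = f t x x" for t x by (simp add: std_coloring_def f_def)
  have same: "f t y = f t x" if "par t x y" for t x y
  proof -
    have "par t x z \<longleftrightarrow> par t y z" for z using that par_trans par_sym by metis
    then show ?thesis by (simp add: f_def marked_class_def)
  qed
  show "coloring (std_coloring p M)" unfolding coloring_def
  proof (intro ballI conjI impI allI)
    fix t u x y assume t: "t \<in> S" and u: "u \<in> perp t" "adj \<Delta> u x y"
    have "f t x x = f t x y" using good[OF t adjD(2)[OF u(2)]] u unfolding good_color_def by auto
    then show "std_coloring p M t x = std_coloring p M t y"
      unfolding std using same[OF par_step[of u t x y]] u by simp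
  next
    fix t x assume t: "t \<in> S" and x: "x \<in> C"
    have "std_coloring p M t y = f t x y" if "y \<in> panel \<Delta> t x" for y
      using that same[OF par_step[of t t x y]] unfolding std panel_iff[OF x] by auto
    moreover have "bij_betw (f t x) (panel \<Delta> t x) (panel \<Delta> t c)"
      using good[OF t x] unfolding good_color_def by simp
    ultimately show "bij_betw (std_coloring p M t) (panel \<Delta> t x) (panel \<Delta> t c)"
      using bij_betw_cong by blast
    show "std_coloring p M t x = c \<longleftrightarrow> t \<notin> down x"
      using good[OF t x] unfolding good_color_def std by simp
  qed
  show "std_coloring p M t m = p t" if t: "t \<in> S" and m: "m \<in> M t" for t m
  proof -
    have "m \<in> marked_class M t m" using m sim_refl[of t m] par_refl[of t m]
      unfolding marked_class_def by blast
    then show ?thesis using good[OF t, of m] M(1)[OF t m] unfolding good_color_def std by auto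
  qed
qed

lemma std_coloring_cong:
  "marked_class M t x = marked_class M' t x \<Longrightarrow> std_coloring p M t x = std_coloring p M' t x"
  by (simp add: std_coloring_def)

end

section \<open>Apartments, roots and wings\<close>

context ra_building
begin

definition chart :: "('w \<Rightarrow> 'c) \<Rightarrow> 'c set \<Rightarrow> bool" where
  "chart a A \<longleftrightarrow> bij_betw a (carrier W) A \<and> A \<subseteq> C \<and>
     (\<forall>v\<in>carrier W. \<forall>w\<in>carrier W. \<delta> (a v) (a w) = inv v \<otimes> w)"

lemma chart_chamber: "chart a A \<Longrightarrow> w \<in> carrier W \<Longrightarrow> a w \<in> A \<and> a w \<in> C"
  unfolding chart_def by (auto simp: bij_betw_def)

lemma chart_dist: "chart a A \<Longrightarrow> v \<in> carrier W \<Longrightarrow> w \<in> carrier W \<Longrightarrow> \<delta> (a v) (a w) = inv v \<otimes> w"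
  unfolding chart_def by blast

lemma chart_surj:
  assumes "chart a A" "x \<in> A" obtains w where "w \<in> carrier W" "x = a w"
  using assms unfolding chart_def by (auto simp: bij_betw_def)

lemma chart_inj: "chart a A \<Longrightarrow> v \<in> carrier W \<Longrightarrow> w \<in> carrier W \<Longrightarrow> a v = a w \<longleftrightarrow> v = w"
  unfolding chart_def by (auto simp: bij_betw_def inj_on_def)

lemma chart_adj:
  assumes "chart a A" "v \<in> carrier W" "w \<in> carrier W"
  shows "adj \<Delta> t (a v) (a w) \<longleftrightarrow> t \<in> S \<and> w = v \<otimes> t"
proof (cases "t \<in> S")
  case True
  have "adj \<Delta> t (a v) (a w) \<longleftrightarrow> inv v \<otimes> w = t"
    using dist_adj[OF True] chart_chamber[OF assms(1)] chart_dist[OF assms] assms by metis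
  also have "\<dots> \<longleftrightarrow> w = v \<otimes> t" using assms True by (intro inv_solve_left') auto
  finally show ?thesis using True by simp
qed (use adjD(1) in blast)

lemma chart_induced:
  assumes ch: "chart a A" shows "right_angled_building W S (induced \<Delta> A)"
proof -
  let ?I = "induced \<Delta> A"
  have I: "chambers ?I = A" "weyl_dist ?I = \<delta>" "adj ?I s x y \<longleftrightarrow> x \<in> A \<and> y \<in> A \<and> adj \<Delta> s x y" for s x y
    by (simp_all add: induced_def)
  have AC: "A \<subseteq> C" using ch by (simp add: chart_def)
  have thin: "y = z" if "adj ?I s x y" "adj ?I s x z" for s x y z
  proof -
    have "x \<in> A" "y \<in> A" "z \<in> A" and xy: "adj \<Delta> s x y" "adj \<Delta> s x z" using that I by auto
    then obtain u v w where w: "u \<in> carrier W" "v \<in> carrier W" "w \<in> carrier W" "x = a u" "y = a v" "z = a w"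
      by (meson chart_surj[OF ch])
    have "v = u \<otimes> s" using chart_adj[OF ch w(1,2)] xy(1) w by blast
    moreover have "w = u \<otimes> s" using chart_adj[OF ch w(1,3)] xy(2) w by blast
    ultimately show ?thesis using w by simp
  qed
  have neighbour: "\<exists>y. adj ?I s x y" if s: "s \<in> S" and x: "x \<in> A" for s x
  proof -
    obtain u where u: "u \<in> carrier W" "x = a u" using chart_surj[OF ch x] .
    then have "adj \<Delta> s x (a (u \<otimes> s))" using chart_adj[OF ch] s by simp
    then show ?thesis using I s x u chart_chamber[OF ch, of "u \<otimes> s"] by auto
  qed
  have "chamber_system S ?I"
    unfolding chamber_system_def
  proof (intro conjI ballI)
    show "edge_colored_graph S ?I"
      unfolding edge_colored_graph_def I using adjD dist_adj by metis
  next
    fix s P assume s: "s \<in> S" and "P \<in> panels_of_type ?I s"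
    then obtain x where x: "x \<in> A" "P = panel ?I s x" by (auto simp: panels_of_type_def I)
    obtain y where y: "adj ?I s x y" using neighbour[OF s x(1)] by blast
    have yx: "adj ?I s y x" using y I adjD(5) by blast
    have reach: "z = x \<or> z = y" if "(adj ?I s)\<^sup>*\<^sup>* x z" for z
      using that by (induction rule: rtranclp_induct) (use thin y yx in blast)+
    have P: "P = {x, y}"
      using reach x y I unfolding panel_def by auto
    show "x' \<noteq> y' \<longrightarrow> adj ?I s x' y'" if "x' \<in> P" "y' \<in> P" for x' y'
      using that y yx unfolding P by auto
    have "x \<noteq> y" using y I adjD(4) by blast
    then show "infinite P \<or> 2 \<le> card P" unfolding P by simp
  qed
  moreover have "\<delta> x y = wp ws \<longleftrightarrow> gallery ?I x ws y"
    if red: "reduced_word W S ws" and x: "x \<in> A" and y: "y \<in> A" for ws x y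
  proof -
    obtain v where v: "v \<in> carrier W" "x = a v" using chart_surj[OF ch x] .
    obtain w where w: "w \<in> carrier W" "y = a w" using chart_surj[OF ch y] .
    have "gallery ?I (a v) ws (a w) \<longleftrightarrow> w = v \<otimes> wp ws" if "ws \<in> lists S" "v \<in> carrier W" for ws v
      using that
    proof (induction ws arbitrary: v rule: list.induct)
      case Nil
      then show ?case using chart_chamber[OF ch] chart_inj[OF ch] w I by auto
    next
      case (Cons s ws)
      then have s: "s \<in> S" "ws \<in> lists S" by auto
      have vs: "v \<otimes> s \<in> carrier W" using s Cons.prems by simp
      have nb: "adj ?I s (a v) e \<longleftrightarrow> e = a (v \<otimes> s)" for e
      proof -
        have "adj ?I s (a v) (a (v \<otimes> s))"
          using I chart_adj[OF ch Cons.prems(2) vs] chart_chamber[OF ch] vs Cons.prems s by blast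
        then show ?thesis using thin by blast
      qed
      have "gallery ?I (a v) (s # ws) (a w) \<longleftrightarrow> gallery ?I (a (v \<otimes> s)) ws (a w)" by (simp add: nb)
      also have "\<dots> \<longleftrightarrow> w = v \<otimes> s \<otimes> wp ws" using Cons.IH[OF s(2) vs] .
      finally show ?case using s Cons.prems by (simp add: m_assoc)
    qed
    moreover have ws: "ws \<in> lists S" using red by (simp add: reduced_word_def)
    moreover have "\<delta> x y = wp ws \<longleftrightarrow> w = v \<otimes> wp ws"
      unfolding v(2) w(2) chart_dist[OF ch v(1) w(1)] using v(1) w(1) wp_closed[OF ws]
      by (intro inv_solve_left')
    ultimately show ?thesis using v w by simp
  qed
  ultimately show ?thesis
    unfolding right_angled_building_def I using cox ra AC dist_closed by blast
qed

text \<open>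
  An isometric image of the standard thin building is automatically a subbuilding, so apartments
  can be handled through their charts alone.
\<close>

lemma apartment_iff_chart: "apartment W S \<Delta> A \<longleftrightarrow> (\<exists>a. chart a A)"
proof
  assume ap: "apartment W S \<Delta> A"
  then obtain a where "bij_betw a (carrier W) A"
      "\<forall>v\<in>carrier W. \<forall>w\<in>carrier W. \<delta> (a v) (a w) = inv v \<otimes> w"
    unfolding apartment_def weyl_isometric_def by (auto simp: standard_thin_building_def induced_def)
  moreover have "A \<subseteq> C" using ap by (simp add: apartment_def subbuilding_def)
  ultimately show "\<exists>a. chart a A" unfolding chart_def by blast
next
  assume "\<exists>a. chart a A"
  then obtain a where ch: "chart a A" by blast
  then have "weyl_isometric (standard_thin_building W S) (induced \<Delta> A)"
    unfolding weyl_isometric_def chart_def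
    by (intro exI[of _ a]) (auto simp: standard_thin_building_def induced_def)
  then show "apartment W S \<Delta> A"
    using chart_induced[OF ch] ch unfolding apartment_def subbuilding_def chart_def by blast
qed

lemma chart_at:
  assumes "apartment W S \<Delta> A" "c \<in> A" obtains a where "chart a A" "a \<one> = c"
proof -
  obtain b where b: "chart b A" using assms apartment_iff_chart by blast
  obtain v where v: "v \<in> carrier W" "c = b v" using chart_surj[OF b assms(2)] .
  define a where "a = (\<lambda>w. b (v \<otimes> w))"
  have "bij_betw (\<lambda>w. v \<otimes> w) (carrier W) (carrier W)"
    by (rule bij_betwI[where g = "\<lambda>w. inv v \<otimes> w"]) (use v in auto)
  then have "bij_betw a (carrier W) A"
    using b bij_betw_trans unfolding chart_def a_def comp_def[symmetric] by (metis (no_types, lifting) bij_betw_cong comp_def)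
  then have "chart a A"
    using b v unfolding chart_def a_def by (simp add: inv_mult_group m_assoc)
  moreover have "a \<one> = c" using v by (simp add: a_def)
  ultimately show thesis using that by blast
qed

lemma gallery_dist_sym: "x \<in> C \<Longrightarrow> y \<in> C \<Longrightarrow> gallery_dist W S \<Delta> x y = len (\<delta> y x)"
  by (simp add: gallery_dist_def dist_inv[of x y])

text \<open>
  The projection of \<open>x\<close> to an \<open>s\<close>-panel is the only chamber \<open>d\<close> of the panel for which \<open>s\<close> is not a descent
  of \<open>\<delta> x d\<close>.
\<close>

lemma wing_iff:
  assumes c: "c \<in> C" and s: "s \<in> S"
  shows "x \<in> wing W S \<Delta> s c \<longleftrightarrow> x \<in> C \<and> s \<notin> desc (\<delta> x c)"
proof (cases "x \<in> C")
  case x: True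
  let ?P = "panel \<Delta> s c"
  have PC: "d \<in> C" if "d \<in> ?P" for d using that by (simp add: panel_def)
  obtain e where e: "e \<in> ?P" "s \<notin> desc (\<delta> x e)" using bottom_ex[OF x c s] .
  have far: "len (\<delta> x e) < len (\<delta> x d)" "s \<in> desc (\<delta> x d)" if "d \<in> ?P" "d \<noteq> e" for d
  proof -
    have ed: "adj \<Delta> s e d" using that e adj_trans adjD(5) unfolding panel_iff[OF c] by metis
    show "len (\<delta> x e) < len (\<delta> x d)"
      unfolding dist_up[OF x ed e(2)] using len_not_desc[OF dist_closed[OF x PC[OF e(1)]] s e(2)] by simp
    show "s \<in> desc (\<delta> x d)" using bottom_unique[OF x ed e(2)] .
  qed
  have am: "is_arg_min (\<lambda>d. gallery_dist W S \<Delta> d x) (\<lambda>d. d \<in> ?P) d \<longleftrightarrow> d = e" for d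
  proof
    assume "is_arg_min (\<lambda>d. gallery_dist W S \<Delta> d x) (\<lambda>d. d \<in> ?P) d"
    then have "d \<in> ?P" "\<not> len (\<delta> x e) < len (\<delta> x d)"
      using gallery_dist_sym[OF PC x] e(1) unfolding is_arg_min_def by auto
    then show "d = e" using far by blast
  next
    assume "d = e"
    have "\<not> len (\<delta> x d) < len (\<delta> x e)" if "d \<in> ?P" for d
      using far(1)[OF that] by (cases "d = e") auto
    then show "is_arg_min (\<lambda>d. gallery_dist W S \<Delta> d x) (\<lambda>d. d \<in> ?P) d"
      using gallery_dist_sym[OF PC x] e(1) unfolding is_arg_min_def \<open>d = e\<close> by auto
  qed
  have "proj_panel W S \<Delta> ?P x = e" unfolding proj_panel_def by (rule the_equality) (simp_all add: am)
  then have "x \<in> wing W S \<Delta> s c \<longleftrightarrow> e = c" using x by (simp add: wing_def)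
  also have "\<dots> \<longleftrightarrow> s \<notin> desc (\<delta> x c)" using e(2) far(2)[of c] panel_iff[OF c] by blast
  finally show ?thesis using x by simp
qed (simp add: wing_def)

text \<open>
  Let \<open>\<alpha>\<close> be cut out by the adjacent chambers \<open>a u\<close> and \<open>a (u \<otimes> r)\<close>. As \<open>c = a \<one>\<close> and \<open>a s\<close> lie on different
  sides, \<open>s \<otimes> u = u \<otimes> r\<close> by folding: both pairs of adjacent chambers define the same reflection.
  Walking through the apartment, membership in either half-space changes exactly when the step
  crosses the wall of this reflection (\<open>desc_flip\<close>), and at \<open>c\<close> the two half-spaces agree.
\<close>

lemma root_chart:
  assumes R: "is_root W S \<Delta> A \<alpha>" and ch: "chart a A" "a \<one> = c" and c: "c \<in> \<alpha>"
    and s: "s \<in> S" and wl: "panel \<Delta> s c \<in> wall S \<Delta> A \<alpha>"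
  shows "\<alpha> = {a w |w. w \<in> carrier W \<and> s \<notin> desc (inv w)}"
proof -
  obtain r x y where r: "r \<in> S" "x \<in> A" "y \<in> A" "adj \<Delta> r x y"
    and \<alpha>: "\<alpha> = {c \<in> A. gallery_dist W S \<Delta> c x < gallery_dist W S \<Delta> c y}"
    using R by (auto simp: is_root_def)
  obtain u where u: "u \<in> carrier W" "x = a u" using chart_surj[OF ch(1) r(2)] .
  obtain u' where u': "u' \<in> carrier W" "y = a u'" using chart_surj[OF ch(1) r(3)] .
  have uu: "u' = u \<otimes> r" using r(4) chart_adj[OF ch(1) u(1) u'(1)] u u' by blast
  have mem: "a w \<in> \<alpha> \<longleftrightarrow> r \<notin> desc (inv w \<otimes> u)" if w: "w \<in> carrier W" for w
  proof -
    have "a w \<in> \<alpha> \<longleftrightarrow> len (inv w \<otimes> u) < len (inv w \<otimes> u \<otimes> r)"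
      using chart_chamber[OF ch(1) w] chart_dist[OF ch(1) w u(1)] chart_dist[OF ch(1) w u'(1)]
        u u' uu w r(1) unfolding \<alpha> gallery_dist_def by (simp add: m_assoc)
    also have "\<dots> \<longleftrightarrow> r \<notin> desc (inv w \<otimes> u)"
      using len_mult_gen_ne[of "inv w \<otimes> u" r] w u r(1) unfolding desc_def by (simp; linarith)
    finally show ?thesis .
  qed
  have one: "r \<notin> desc u" using mem[of \<one>] c ch(2) u by simp
  have cC: "c \<in> C" using chart_chamber[OF ch(1), of \<one>] ch(2) by simp
  obtain d where d: "d \<in> panel \<Delta> s c" "d \<in> A" "d \<notin> \<alpha>" using wl unfolding wall_def by blast
  then have "adj \<Delta> s c d" using c unfolding panel_iff[OF cC] by auto
  moreover obtain v where v: "v \<in> carrier W" "d = a v" using chart_surj[OF ch(1) d(2)] .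
  ultimately have "d = a s" using chart_adj[OF ch(1), of \<one> v s] ch(2) s by simp
  then have "r \<in> desc (s \<otimes> u)" using mem[of s] d(3) s by simp
  then have su: "s \<otimes> u = u \<otimes> r" using folding[OF u(1) s r(1) one] by blast
  have eq: "r \<in> desc (wp ws \<otimes> u) \<longleftrightarrow> s \<in> desc (wp ws)" if "ws \<in> lists S" for ws
    using that
  proof (induction ws)
    case Nil
    then show ?case using one u by simp
  next
    case (Cons t ws)
    then have t: "t \<in> S" and v: "wp ws \<in> carrier W" by auto
    have "(r \<in> desc (t \<otimes> (wp ws \<otimes> u))) \<noteq> (r \<in> desc (wp ws \<otimes> u)) \<longleftrightarrow> t \<otimes> (wp ws \<otimes> u) = wp ws \<otimes> u \<otimes> r"
      by (rule desc_flip) (use t v u r in auto)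
    also have "wp ws \<otimes> u \<otimes> r = wp ws \<otimes> s \<otimes> u" using v u r s by (simp add: m_assoc su)
    also have "t \<otimes> (wp ws \<otimes> u) = t \<otimes> wp ws \<otimes> u" using t v u by (simp add: m_assoc)
    also have "t \<otimes> wp ws \<otimes> u = wp ws \<otimes> s \<otimes> u \<longleftrightarrow> t \<otimes> wp ws = wp ws \<otimes> s"
      using t v u s by (intro right_cancel) auto
    also have "\<dots> \<longleftrightarrow> (s \<in> desc (t \<otimes> wp ws)) \<noteq> (s \<in> desc (wp ws))"
      using desc_flip[OF v t s] by blast
    finally have "(r \<in> desc (t \<otimes> wp ws \<otimes> u)) \<noteq> (r \<in> desc (wp ws \<otimes> u))
        \<longleftrightarrow> (s \<in> desc (t \<otimes> wp ws)) \<noteq> (s \<in> desc (wp ws))" .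
    then show ?case using Cons by auto
  qed
  have "a w \<in> \<alpha> \<longleftrightarrow> s \<notin> desc (inv w)" if w: "w \<in> carrier W" for w
    using mem[OF w] eq wp_surj[OF inv_closed[OF w]] by metis
  moreover have "\<alpha> \<subseteq> A" by (auto simp: \<alpha>)
  ultimately show ?thesis using chart_surj[OF ch(1)] by blast
qed

lemma not_left_desc_prefix:
  assumes "v \<in> carrier W" "t \<in> desc v" "s \<in> S" "s \<notin> desc (inv v)" shows "s \<notin> desc (inv (v \<otimes> t))"
proof
  assume d: "s \<in> desc (inv (v \<otimes> t))"
  have t: "t \<in> S" using assms desc_S by blast
  have e: "inv (v \<otimes> t) \<otimes> s = inv (s \<otimes> v \<otimes> t)" using assms t by (simp add: inv_mult_group m_assoc)
  have "len (inv (v \<otimes> t) \<otimes> s) < len (inv (v \<otimes> t))" using d by (simp add: desc_def)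
  then have "len (s \<otimes> v \<otimes> t) < len (v \<otimes> t)" unfolding e using assms t by simp
  then have "len (s \<otimes> v) < len v"
    using len_mult_le[of "s \<otimes> v \<otimes> t" t] len_desc[OF assms(1,2)] assms t by simp
  moreover have e': "inv v \<otimes> s = inv (s \<otimes> v)" using assms by (simp add: inv_mult_group)
  have "len (inv v \<otimes> s) = len (s \<otimes> v)" unfolding e' using assms by simp
  ultimately show False using assms by (simp add: desc_def)
qed

end

context pointed_ra_building
begin

text \<open>
  Mark in each apartment the chambers \<open>a w\<close> with \<open>t\<close> a descent of \<open>w\<close>, and let all of them have the same
  \<open>t\<close>-colour. Then both apartments consist of the chambers whose reduced galleries from \<open>c\<close> only use
  these distinguished colours, so that the automorphism from the first colouring to the second one
  maps \<open>A\<close> onto \<open>A'\<close>. It fixes the wing pointwise because the two colourings agree there in all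
  positions that matter. Namely, let \<open>x\<close> be a chamber of the wing with descent \<open>t\<close> and let the residue
  \<open>par t x\<close> contain a mark \<open>a w\<close>. By \<open>par_dist\<close>, \<open>a w\<close> may be replaced by \<open>a (\<delta> c x)\<close>, which has the same
  distance from \<open>c\<close> as \<open>x\<close> and hence lies in the half of the apartment that \<open>A\<close> and \<open>A'\<close> share.
\<close>

lemma wing_fixing_automorphism:
  assumes semi: "semi_regular S \<Delta>" and s: "s \<in> S"
    and a: "chart a A" "a \<one> = c" and a': "chart a' A'" "a' \<one> = c"
    and agree: "\<And>w. w \<in> carrier W \<Longrightarrow> s \<notin> desc (inv w) \<Longrightarrow> a' w = a w"
  obtains g where "g \<in> fixator S \<Delta> (wing W S \<Delta> s c)" "g ` A = A'"
proof -
  have dc: "\<delta> c (b w) = w" if "chart b B" "b \<one> = c" "w \<in> carrier W" for b B w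
    using chart_dist[OF that(1), of \<one> w] that by simp
  define M where "M b t = b ` {w \<in> carrier W. t \<in> desc w}" for b :: "'w \<Rightarrow> 'c" and t
  have p: "a t \<in> panel \<Delta> t c \<and> a t \<noteq> c" if "t \<in> S" for t
  proof -
    have "adj \<Delta> t c (a t)" using chart_adj[OF a(1), of \<one> t t] a(2) that by simp
    then show ?thesis using panel_iff[OF c_chamber] adjD(4) by blast
  qed
  have chart_sim: "sim t (b v) (b (v \<otimes> wp k))"
    if "chart b B" "v \<in> carrier W" "k \<in> lists (perp t)" for b B v k t
    using that(3,2)
  proof (induction k arbitrary: v)
    case (Cons u k)
    then have u: "u \<in> S" "u \<in> perp t" and k: "k \<in> lists S" using perp_lists perp_S by auto
    have "adj \<Delta> u (b v) (b (v \<otimes> u))" using chart_adj[OF that(1)] u Cons.prems by simp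
    then have "sim t (b v) (b (v \<otimes> u \<otimes> wp k))"
      using sim_trans[OF sim_step[OF u(2)]] Cons u by (metis Cons_in_lists_iff S_carrier m_closed)
    then show ?case using u k Cons.prems by (simp add: m_assoc)
  qed simp
  have col: "coloring (std_coloring a (M b))"
      "\<And>t m. t \<in> S \<Longrightarrow> m \<in> M b t \<Longrightarrow> std_coloring a (M b) t m = a t"
    if b: "chart b B" "b \<one> = c" for b B
  proof -
    have 1: "m \<in> C \<and> t \<in> down m" if "m \<in> M b t" for t m
      using that dc[OF b] chart_chamber[OF b(1)] by (auto simp: M_def)
    have 2: "sim t m m'" if m: "m \<in> M b t" "m' \<in> M b t" and mm: "par t m m'" for t m m'
    proof -
      obtain w w' where w: "w \<in> carrier W" "m = b w" "w' \<in> carrier W" "m' = b w'"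
        using m by (auto simp: M_def)
      obtain k where "k \<in> lists (perp t)" "\<delta> c m' = \<delta> c m \<otimes> wp k"
        using par_dist[OF mm _ c_chamber] 1 m by metis
      then show ?thesis using chart_sim[OF b(1) w(1)] dc[OF b] w by metis
    qed
    show "coloring (std_coloring a (M b))"
        "\<And>t m. t \<in> S \<Longrightarrow> m \<in> M b t \<Longrightarrow> std_coloring a (M b) t m = a t"
      using std_coloring[OF semi, of a "M b"] p 1 2 by blast+
  qed
  let ?h = "std_coloring a (M a)" and ?h' = "std_coloring a (M a')"
  note h = col(1)[OF a] and h' = col(1)[OF a']
  have wing_dist: "x \<in> wing W S \<Delta> s c \<longleftrightarrow> x \<in> C \<and> s \<notin> desc (inv (\<delta> c x))" for x
    using wing_iff[OF c_chamber s] dist_inv[OF c_chamber] by auto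
  have same: "?h t x = ?h' t x" if x: "x \<in> wing W S \<Delta> s c" "t \<in> down x" for t x
  proof -
    have xC: "x \<in> C" and xs: "s \<notin> desc (inv (\<delta> c x))" using x wing_dist by auto
    have t: "t \<in> S" using x desc_S by blast
    have v: "\<delta> c x \<in> carrier W" using xC by simp
    have mark: "b (\<delta> c x) \<in> M b t \<and> sim t (b (\<delta> c x)) y"
      if b: "chart b B" "b \<one> = c" and y: "par t x y" "m \<in> M b t" "sim t m y" for b B y m
    proof -
      obtain w where w: "w \<in> carrier W" "m = b w" "t \<in> desc w" using y(2) by (auto simp: M_def)
      have "par t x m" using par_trans[OF y(1) par_sym[OF sim_par[OF y(3)]]] .
      moreover have "t \<in> down m" using dc[OF b w(1)] w by simp
      ultimately obtain k where k: "k \<in> lists (perp t)" "\<delta> c m = \<delta> c x \<otimes> wp k"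
        by (rule par_dist[OF _ xC c_chamber x(2)])
      have "sim t (b (\<delta> c x)) m" using chart_sim[OF b(1) v k(1)] k(2) dc[OF b w(1)] w(2) by simp
      then show ?thesis using sim_trans y(3) v x(2) by (auto simp: M_def)
    qed
    have e: "a' (\<delta> c x) = a (\<delta> c x)" using agree[OF v xs] .
    have "marked_class (M a) t x = marked_class (M a') t x"
    proof (rule subset_antisym; rule subsetI)
      fix y assume "y \<in> marked_class (M a) t x"
      then have "par t x y" "a (\<delta> c x) \<in> M a t" "sim t (a (\<delta> c x)) y"
        using mark[OF a] unfolding marked_class_def by blast+
      moreover have "a' (\<delta> c x) \<in> M a' t" using v x(2) by (simp add: M_def)
      ultimately show "y \<in> marked_class (M a') t x" unfolding marked_class_def using e by auto
    next
      fix y assume "y \<in> marked_class (M a') t x"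
      then have "par t x y" "a' (\<delta> c x) \<in> M a' t" "sim t (a' (\<delta> c x)) y"
        using mark[OF a'] unfolding marked_class_def by blast+
      moreover have "a (\<delta> c x) \<in> M a t" using v x(2) by (simp add: M_def)
      ultimately show "y \<in> marked_class (M a) t x" unfolding marked_class_def using e by auto
    qed
    then show ?thesis by (rule std_coloring_cong)
  qed
  obtain g where g: "g \<in> carrier (Aut S \<Delta>)" "\<And>x y. transport ?h ?h' x y \<Longrightarrow> g x = y"
    using coloring_automorphism[OF h h'] by metis
  have fix_wing: "transport ?h ?h' x x" if "x \<in> wing W S \<Delta> s c" for x
    using that
  proof (induction "len (\<delta> c x)" arbitrary: x rule: less_induct)
    case less
    then have xC: "x \<in> C" and xs: "s \<notin> desc (inv (\<delta> c x))" using wing_dist by auto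
    show ?case
    proof (cases "x = c")
      case False
      then have "\<delta> c x \<noteq> \<one>" using dist_one_iff xC by auto
      then obtain t where t: "t \<in> down x" using desc_ex dist_closed[OF c_chamber xC] by metis
      obtain e where e: "adj \<Delta> t x e" "\<delta> c e = \<delta> c x \<otimes> t" using down_ex[OF c_chamber xC t] .
      have ne: "t \<notin> down e" using down_iff[OF c_chamber e(1) t] e(2) by simp
      note ae = adjD[OF e(1)]
      have "e \<in> wing W S \<Delta> s c"
        using wing_dist ae(3) e(2) not_left_desc_prefix[OF _ t s xs] xC by simp
      then have "transport ?h ?h' e e" using less.hyps[OF len_lt[OF ae(3,5) ne]] by blast
      then show ?thesis using transport.step[OF _ ae(5) ne ae(5)] same[OF less.prems t] by blast
    qed (use transport.base in simp)
  qed
  have map_chart: "transport ?h ?h' (a w) (a' w)" if "w \<in> carrier W" for w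
    using that
  proof (induction "len w" arbitrary: w rule: less_induct)
    case less
    show ?case
    proof (cases "w = \<one>")
      case True
      then show ?thesis using transport.base a a' by simp
    next
      case False
      obtain t where t: "t \<in> desc w" using desc_ex[OF less.prems False] .
      then have tS: "t \<in> S" by (rule desc_S)
      have wt: "w \<otimes> t \<in> carrier W" using less.prems tS by simp
      have n: "t \<notin> desc (w \<otimes> t)" using desc_mult[OF less.prems tS] t by simp
      have IH: "transport ?h ?h' (a (w \<otimes> t)) (a' (w \<otimes> t))"
        using less.hyps[OF _ wt] len_desc[OF less.prems t] by simp
      have e: "adj \<Delta> t (a (w \<otimes> t)) (a w)" "adj \<Delta> t (a' (w \<otimes> t)) (a' w)"
        using chart_adj[OF a(1) wt less.prems] chart_adj[OF a'(1) wt less.prems] tS less.prems by auto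
      have "a w \<in> M a t" "a' w \<in> M a' t" using less.prems t by (auto simp: M_def)
      then have "?h t (a w) = ?h' t (a' w)" using col(2)[OF a tS] col(2)[OF a' tS] by simp
      then show ?thesis using transport.step[OF IH e(1) _ e(2)] n dc[OF a wt] by simp
    qed
  qed
  have "g ` A = A'"
  proof -
    have "A = a ` carrier W" "A' = a' ` carrier W" using a a' by (auto simp: chart_def bij_betw_def)
    moreover have "g (a w) = a' w" if "w \<in> carrier W" for w using g(2) map_chart that by blast
    ultimately show ?thesis by (simp add: image_image)
  qed
  moreover have "g \<in> fixator S \<Delta> (wing W S \<Delta> s c)" using g fix_wing unfolding fixator_def by blast
  ultimately show thesis using that by blast
qed

end

section \<open>The action of the root wing group\<close>

context ra_building
begin

lemma Aut_D:
  assumes "g \<in> carrier (Aut S \<Delta>)"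
  shows "g \<in> Bij C" "bij_betw g C C" "\<And>x. x \<in> C \<Longrightarrow> g x \<in> C"
    "\<And>t x y. t \<in> S \<Longrightarrow> x \<in> C \<Longrightarrow> y \<in> C \<Longrightarrow> adj \<Delta> t (g x) (g y) \<longleftrightarrow> adj \<Delta> t x y"
  using assms by (auto simp: Aut_def Bij_def bij_betw_apply)

lemma Aut_gallery:
  assumes g: "g \<in> carrier (Aut S \<Delta>)" shows "gallery \<Delta> x ws y \<Longrightarrow> gallery \<Delta> (g x) ws (g y)"
proof (induction ws arbitrary: x)
  case (Cons t ws)
  then obtain e where e: "adj \<Delta> t x e" "gallery \<Delta> e ws y" by auto
  then show ?case using Cons.IH[OF e(2)] Aut_D(4)[OF g] adjD[OF e(1)] by auto
qed (use Aut_D(3)[OF g] in auto)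

lemma Aut_dist:
  assumes g: "g \<in> carrier (Aut S \<Delta>)" and "x \<in> C" "y \<in> C" shows "\<delta> (g x) (g y) = \<delta> x y"
proof -
  obtain ws where ws: "reduced_word W S ws" "wp ws = \<delta> x y" "gallery \<Delta> x ws y"
    using dist_gallery_ex[OF assms(2,3)] by metis
  have "\<delta> (g x) (g y) = wp ws"
    using dist_gallery[OF ws(1)] Aut_gallery[OF g ws(3)] Aut_D(3)[OF g] assms by blast
  then show ?thesis using ws(2) by simp
qed

lemma Aut_apartment:
  assumes g: "g \<in> carrier (Aut S \<Delta>)" and A: "apartment W S \<Delta> A" shows "apartment W S \<Delta> (g ` A)"
proof -
  obtain a where a: "chart a A" using A apartment_iff_chart by blast
  have AC: "A \<subseteq> C" using a by (simp add: chart_def)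
  have "bij_betw g A (g ` A)"
    using Aut_D(2)[OF g] AC by (meson bij_betw_def bij_betw_imageI inj_on_subset)
  then have "bij_betw (g \<circ> a) (carrier W) (g ` A)" using a bij_betw_trans unfolding chart_def by blast
  moreover have "g ` A \<subseteq> C" using AC Aut_D(3)[OF g] by blast
  moreover have "\<delta> ((g \<circ> a) v) ((g \<circ> a) w) = inv v \<otimes> w" if "v \<in> carrier W" "w \<in> carrier W" for v w
    using Aut_dist[OF g] chart_chamber[OF a] chart_dist[OF a] that by simp
  ultimately have "chart (g \<circ> a) (g ` A)" unfolding chart_def by blast
  then show ?thesis using apartment_iff_chart by blast
qed

lemma fixator_subgroup:
  assumes X: "X \<subseteq> C" shows "subgroup (fixator S \<Delta> X) (BijGroup C)"
proof -
  interpret B: group "BijGroup C" by (rule group_BijGroup)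
  have fix_iff: "g \<in> fixator S \<Delta> X \<longleftrightarrow> g \<in> Bij C \<and>
      (\<forall>t\<in>S. \<forall>x\<in>C. \<forall>y\<in>C. adj \<Delta> t (g x) (g y) \<longleftrightarrow> adj \<Delta> t x y) \<and> (\<forall>x\<in>X. g x = x)" for g
    by (auto simp: fixator_def Aut_def)
  have BC: "g x \<in> C" if "g \<in> Bij C" "x \<in> C" for g x
    using that by (auto simp: Bij_def bij_betw_apply)
  show ?thesis
  proof (rule B.subgroupI)
    show "fixator S \<Delta> X \<subseteq> carrier (BijGroup C)" by (auto simp: fix_iff BijGroup_def)
    have "(\<lambda>x\<in>C. x) \<in> fixator S \<Delta> X" unfolding fix_iff using X id_Bij by auto
    then show "fixator S \<Delta> X \<noteq> {}" by blast
  next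
    fix g assume g: "g \<in> fixator S \<Delta> X"
    then have gB: "g \<in> Bij C" by (simp add: fix_iff)
    then have bij: "bij_betw g C C" by (simp add: Bij_def)
    let ?k = "\<lambda>x\<in>C. inv_into C g x"
    have inv: "inv\<^bsub>BijGroup C\<^esub> g = ?k" using inv_BijGroup[OF gB] .
    have k: "?k x \<in> C" "g (?k x) = x" if "x \<in> C" for x
      using that bij Bij_inv_into_mem[OF gB] by (auto simp: bij_betw_inv_into_right)
    have "?k x = x" if "x \<in> X" for x
    proof -
      have "x \<in> C" "g x = x" using that X g by (auto simp: fix_iff)
      then show ?thesis using bij by (metis bij_betw_inv_into_left restrict_apply')
    qed
    moreover have "adj \<Delta> t (?k x) (?k y) \<longleftrightarrow> adj \<Delta> t x y" if "t \<in> S" "x \<in> C" "y \<in> C" for t x y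
      using g that k[OF that(2)] k[OF that(3)] unfolding fix_iff by metis
    ultimately show "inv\<^bsub>BijGroup C\<^esub> g \<in> fixator S \<Delta> X"
      unfolding inv fix_iff using restrict_inv_into_Bij[OF gB] by blast
  next
    fix g h assume g: "g \<in> fixator S \<Delta> X" and h: "h \<in> fixator S \<Delta> X"
    then have B: "g \<in> Bij C" "h \<in> Bij C" by (auto simp: fix_iff)
    have m: "g \<otimes>\<^bsub>BijGroup C\<^esub> h = compose C g h" using B by (simp add: BijGroup_def)
    show "g \<otimes>\<^bsub>BijGroup C\<^esub> h \<in> fixator S \<Delta> X"
      unfolding m fix_iff
      using compose_Bij[OF B] g h X BC[OF B(2)] by (auto simp: fix_iff compose_def subset_iff)
  qed
qed

lemma fixator_group_action:
  assumes X: "X \<subseteq> C" "\<alpha> \<subseteq> X"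
  defines "E \<equiv> {A. apartment W S \<Delta> A \<and> \<alpha> \<subseteq> A}"
  shows "group_action (Aut S \<Delta>\<lparr>carrier := fixator S \<Delta> X\<rparr>) E (\<lambda>g. \<lambda>A\<in>E. g ` A)"
proof -
  let ?U = "fixator S \<Delta> X"
  let ?G = "Aut S \<Delta>\<lparr>carrier := ?U\<rparr>"
  interpret B: group "BijGroup C" by (rule group_BijGroup)
  have GB: "?G = BijGroup C\<lparr>carrier := ?U\<rparr>" by (simp add: Aut_def)
  have sub: "subgroup ?U (BijGroup C)" by (rule fixator_subgroup[OF X(1)])
  have G: "group ?G" unfolding GB by (rule B.subgroup_imp_group[OF sub])
  have U: "g \<in> carrier (Aut S \<Delta>)" "g \<in> Bij C" "\<And>x. x \<in> X \<Longrightarrow> g x = x" if "g \<in> ?U" for g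
    using that Aut_D(1) by (auto simp: fixator_def)
  have EC: "A \<subseteq> C" if "A \<in> E" for A
    using that by (simp add: E_def apartment_def subbuilding_def)
  have img: "g ` A \<in> E" if "g \<in> ?U" "A \<in> E" for g A
  proof -
    have "\<alpha> = g ` \<alpha>" using U(3)[OF that(1)] X(2) by force
    also have "\<dots> \<subseteq> g ` A" using that(2) by (auto simp: E_def)
    finally show ?thesis using Aut_apartment[OF U(1)] that by (simp add: E_def)
  qed
  have mult: "(g \<otimes>\<^bsub>?G\<^esub> h) ` A = g ` (h ` A)" if "g \<in> ?U" "h \<in> ?U" "A \<in> E" for g h A
  proof -
    have m: "g \<otimes>\<^bsub>?G\<^esub> h = compose C g h" unfolding GB using U(2) that by (simp add: BijGroup_def)
    show ?thesis unfolding m using EC[OF that(3)] by (force simp: compose_def image_image)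
  qed
  have bij: "(\<lambda>A\<in>E. g ` A) \<in> Bij E" if g: "g \<in> ?U" for g
  proof -
    have h: "inv\<^bsub>?G\<^esub> g \<in> ?U" "g \<in> carrier ?G" using group.inv_closed[OF G, of g] g by auto
    have one: "\<one>\<^bsub>?G\<^esub> ` A = A" if "A \<in> E" for A
      unfolding GB using EC[OF that] by (force simp: BijGroup_def)
    have 1: "(inv\<^bsub>?G\<^esub> g) ` (g ` A) = A" "g ` ((inv\<^bsub>?G\<^esub> g) ` A) = A" if "A \<in> E" for A
      using mult[OF h(1) g that] mult[OF g h(1) that] one[OF that]
        group.l_inv[OF G h(2)] group.r_inv[OF G h(2)] by simp_all
    have "bij_betw (\<lambda>A\<in>E. g ` A) E E"
      by (rule bij_betwI[where g = "\<lambda>A. (inv\<^bsub>?G\<^esub> g) ` A"]) (use img g h 1 in auto)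
    then show ?thesis by (simp add: Bij_def)
  qed
  have "(\<lambda>g. \<lambda>A\<in>E. g ` A) \<in> hom ?G (BijGroup E)"
  proof (rule homI)
    fix g assume "g \<in> carrier ?G"
    then show "(\<lambda>A\<in>E. g ` A) \<in> carrier (BijGroup E)" using bij by (simp add: BijGroup_def)
  next
    fix g h assume "g \<in> carrier ?G" "h \<in> carrier ?G"
    then have gh: "g \<in> ?U" "h \<in> ?U" by auto
    have "(\<lambda>A\<in>E. g ` A) \<otimes>\<^bsub>BijGroup E\<^esub> (\<lambda>A\<in>E. h ` A) = compose E (\<lambda>A\<in>E. g ` A) (\<lambda>A\<in>E. h ` A)"
      using bij[OF gh(1)] bij[OF gh(2)] by (simp add: BijGroup_def)
    also have "\<dots> = (\<lambda>A\<in>E. (g \<otimes>\<^bsub>?G\<^esub> h) ` A)"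
      using mult[OF gh] img[OF gh(2)] by (intro ext) (simp add: compose_def restrict_def)
    finally show "(\<lambda>A\<in>E. (g \<otimes>\<^bsub>?G\<^esub> h) ` A) = (\<lambda>A\<in>E. g ` A) \<otimes>\<^bsub>BijGroup E\<^esub> (\<lambda>A\<in>E. h ` A)" by simp
  qed
  then show ?thesis
    using G group_BijGroup by (auto simp: group_action_def group_hom_def group_hom_axioms_def)
qed

end

theorem proposition4p7:
  fixes W :: "'w monoid" and S :: "'w set" and \<Delta> :: "('c, 'w) building"
    and A \<alpha> :: "'c set" and U :: "('c \<Rightarrow> 'c) set"
  assumes "right_angled_building W S \<Delta>"
    and "thick S \<Delta>"
    and "semi_regular S \<Delta>"
    and "apartment W S \<Delta> A"
    and "is_root W S \<Delta> A \<alpha>"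
    and "root_wing_group W S \<Delta> A \<alpha> U"
  shows "transitive_action ((Aut S \<Delta>)\<lparr>carrier := U\<rparr>)
           {A'. apartment W S \<Delta> A' \<and> \<alpha> \<subseteq> A'}
           (\<lambda>g. \<lambda>A'\<in>{A'. apartment W S \<Delta> A' \<and> \<alpha> \<subseteq> A'}. g ` A')"
proof -
  have cox: "coxeter_system W S" "right_angled W S"
    using assms(1) unfolding right_angled_building_def by blast+
  then have "group W" unfolding coxeter_system_def by blast
  then interpret ra_building W S \<Delta>
    using cox assms(1)
    by (simp add: ra_building_def ra_coxeter_def ra_coxeter_axioms_def ra_building_axioms_def)
  let ?E = "{A'. apartment W S \<Delta> A' \<and> \<alpha> \<subseteq> A'}"
  obtain s c where s: "s \<in> S" and c: "c \<in> \<alpha>" and wl: "panel \<Delta> s c \<in> wall S \<Delta> A \<alpha>"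
    and U: "U = fixator S \<Delta> (wing W S \<Delta> s c)"
    using assms(6) unfolding root_wing_group_def by blast
  have \<alpha>A: "\<alpha> \<subseteq> A" using assms(5) by (auto simp: is_root_def)
  obtain a where a: "chart a A" "a \<one>\<^bsub>W\<^esub> = c" using chart_at[OF assms(4)] c \<alpha>A by blast
  have cC: "c \<in> C" using chart_chamber[OF a(1), of "\<one>\<^bsub>W\<^esub>"] a(2) by simp
  interpret pointed_ra_building W S \<Delta> c by unfold_locales (rule cC)
  have \<alpha>: "\<alpha> = {a w |w. w \<in> carrier W \<and> s \<notin> desc (inv\<^bsub>W\<^esub> w)}"
    by (rule root_chart[OF assms(5) a c s wl])
  have \<alpha>_wing: "\<alpha> \<subseteq> wing W S \<Delta> s c"
  proof
    fix x assume "x \<in> \<alpha>"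
    then obtain w where w: "w \<in> carrier W" "x = a w" "s \<notin> desc (inv\<^bsub>W\<^esub> w)" using \<alpha> by blast
    then have "\<delta> x c = inv\<^bsub>W\<^esub> w" using chart_dist[OF a(1) w(1), of "\<one>\<^bsub>W\<^esub>"] a(2) by simp
    then show "x \<in> wing W S \<Delta> s c" using wing_iff[OF cC s] w chart_chamber[OF a(1) w(1)] by simp
  qed
  have wing_C: "wing W S \<Delta> s c \<subseteq> C" by (auto simp: wing_def)
  have charts: "\<exists>b. chart b B \<and> b \<one>\<^bsub>W\<^esub> = c \<and> (\<forall>w\<in>carrier W. s \<notin> desc (inv\<^bsub>W\<^esub> w) \<longrightarrow> b w = a w)"
    if B: "B \<in> ?E" for B
  proof -
    obtain b where b: "chart b B" "b \<one>\<^bsub>W\<^esub> = c" using chart_at[of B c] B c by blast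
    have "b w = a w" if w: "w \<in> carrier W" "s \<notin> desc (inv\<^bsub>W\<^esub> w)" for w
    proof -
      have "a w \<in> B" using \<alpha> w B by blast
      then obtain v where v: "v \<in> carrier W" "a w = b v" using chart_surj[OF b(1)] by blast
      have "v = \<delta> c (b v)" using chart_dist[OF b(1) one_closed v(1)] b(2) v by simp
      also have "\<dots> = w" unfolding v(2)[symmetric] using chart_dist[OF a(1) one_closed w(1)] a(2) w by simp
      finally show ?thesis using v by simp
    qed
    then show ?thesis using b by blast
  qed
  show ?thesis unfolding U
  proof (intro transitive_action.intro transitive_action_axioms.intro)
    show "group_action (Aut S \<Delta>\<lparr>carrier := fixator S \<Delta> (wing W S \<Delta> s c)\<rparr>) ?E (\<lambda>g. \<lambda>A'\<in>?E. g ` A')"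
      by (rule fixator_group_action[OF wing_C \<alpha>_wing])
  next
    fix X Y assume X: "X \<in> ?E" and Y: "Y \<in> ?E"
    obtain b where b: "chart b X" "b \<one>\<^bsub>W\<^esub> = c"
      "\<And>w. w \<in> carrier W \<Longrightarrow> s \<notin> desc (inv\<^bsub>W\<^esub> w) \<Longrightarrow> b w = a w" using charts[OF X] by blast
    obtain b' where b': "chart b' Y" "b' \<one>\<^bsub>W\<^esub> = c"
      "\<And>w. w \<in> carrier W \<Longrightarrow> s \<notin> desc (inv\<^bsub>W\<^esub> w) \<Longrightarrow> b' w = a w" using charts[OF Y] by blast
    obtain g where "g \<in> fixator S \<Delta> (wing W S \<Delta> s c)" "g ` X = Y"
      using wing_fixing_automorphism[OF assms(3) s b(1,2) b'(1,2)] b(3) b'(3) by metis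
    then show "\<exists>g\<in>carrier (Aut S \<Delta>\<lparr>carrier := fixator S \<Delta> (wing W S \<Delta> s c)\<rparr>). (\<lambda>A'\<in>?E. g ` A') X = Y"
      using X by (intro bexI[of _ g]) simp_all
  qed
qed

end
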